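(* Let $n\ge2$, $\mathfrak g=\mathfrak{sl}_n$, and let $\lambda\in\mathbb C$, $\lambda\ne0$. Let $\pi:\hat{\mathfrak g}\to\mathrm{End}(\mathcal S(R_-^n)_\lambda)$ be the linear map, with $\pi(K)=1$, given as follows. For $a\in\mathfrak g$ and $j\ge0$, $\pi(at^j)$ is obtained by linear extension from $$\pi(E_{uv}t^j)=-\sum_{i=1}^\infty x^v_{-i-j}\,\partial_{x^u_{-i}};$$ and for $j>0$ and $u\ne v$, $$\pi(E_{uv}t^{-j})=-\lambda^{-j}\pi_t^j\sum_{i=1}^\infty x_{-i}^v\,\partial_{x_{-i-j}^u},$$ $$\pi((E_{uu}-E_{vv})t^{-j})=-\lambda^{-j}\pi_t^j\sum_{i=1}^\infty\left(x_{-i}^u\,\partial_{x_{-i-j}^u}-x_{-i}^v\,\partial_{x_{-i-j}^v}\right).$$ Then this gives a representation of the affine Kac–Moody algebra $\hat{\mathfrak g}$ on $\mathcal S(R_-^n)_\lambda$ with central charge $1$ (that is, $K$ acts as $1$).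
   Context: $R_-^n=\mathbb R^n[t^{-1}]t^{-1}$; an element is written $x=\sum_{i\ge1}\sum_{j=1}^n x_{-i}^je_jt^{-i}$ (finitely many non-zero coordinates, $e_j$ the standard basis of $\mathbb R^n$), equivalently as a sequence $(x_{-1},x_{-2},\dots)$ with $x_{-i}\in\mathbb R^n$. $\mathcal S(R_-^n)$ is the space of complex-valued functions on $R_-^n$ whose restriction to every finite-dimensional subspace is a Schwartz function. The operator $\pi_t$ on $\mathcal S(R_-^n)$ is $$\pi_tf(x_{-1},x_{-2},\dots)=\int_{\mathbb R^n}f(y,x_{-1},x_{-2},\dots)\,dy$$ (Lebesgue measure), and $\mathcal S(R_-^n)_\lambda=\{f\in\mathcal S(R_-^n):\pi_tf=\lambda f\}$. $E_{uv}$ is the $n\times n$ matrix with $(u,v)$-entry $1$ and all other entries $0$. The affine algebra is $\hat{\mathfrak g}=\mathfrak{sl}_n\otimes\mathbb C[t,t^{-1}]\oplus\mathbb CK$ with $K$ central and $[at^m,bt^k]=[a,b]t^{m+k}+m\,\delta_{m+k,0}\,\mathrm{tr}(ab)\,K$. *)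

theory Defs
  imports "HOL-Analysis.Analysis" "HOL-Analysis.Finite_Function_Topology"
begin


section \<open>The space of sequences and its coordinates\<close>

text \<open>
  An element of \<open>R\<^sub>-\<^sup>n\<close> is a finitely supported map; the coefficient of \<open>t\<^sup>-\<^sup>i\<close>
  (\<open>i \<ge> 1\<close>) is stored at key \<open>i - 1\<close>. The real vector space structure and the norm (only used
  on finite-dimensional subspaces, where all norms are equivalent) are those of
  \<^theory>\<open>HOL-Analysis.Finite_Function_Topology\<close>.
\<close>

type_synonym 'n rminus = "(nat, real^'n) poly_mapping"

text \<open>\<open>coord v i x\<close> is \<open>x\<^sup>v\<^sub>-\<^sub>i\<close> and \<open>basis_vec u i\<close> is \<open>e\<^sub>u t\<^sup>-\<^sup>i\<close>; both are meant for \<open>i \<ge> 1\<close>.\<close>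

definition coord :: "'n::finite \<Rightarrow> nat \<Rightarrow> 'n rminus \<Rightarrow> real" where
  "coord v i x = Poly_Mapping.lookup x (i - 1) $ v"

definition basis_vec :: "'n::finite \<Rightarrow> nat \<Rightarrow> 'n rminus" where
  "basis_vec u i = Poly_Mapping.single (i - 1) (axis u 1)"

lift_definition seq_cons :: "real^'n::finite \<Rightarrow> 'n rminus \<Rightarrow> 'n rminus"
  is "\<lambda>y x k. case k of 0 \<Rightarrow> y | Suc l \<Rightarrow> x l"
proof -
  fix y :: "real^'n" and x :: "nat \<Rightarrow> real^'n"
  assume "finite {k. x k \<noteq> 0}"
  then have "finite (insert 0 (Suc ` {k. x k \<noteq> 0}))" by simp
  moreover have "{k. (case k of 0 \<Rightarrow> y | Suc l \<Rightarrow> x l) \<noteq> 0} \<subseteq> insert 0 (Suc ` {k. x k \<noteq> 0})"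
    using not0_implies_Suc by (fastforce split: nat.splits)
  ultimately show "finite {k. (case k of 0 \<Rightarrow> y | Suc l \<Rightarrow> x l) \<noteq> 0}"
    by (rule rev_finite_subset)
qed

lemma coord_seq_cons:
  "coord v 1 (seq_cons y x) = y $ v"
  "i \<ge> 1 \<Longrightarrow> coord v (Suc i) (seq_cons y x) = coord v i x"
  by (auto simp: coord_def seq_cons.rep_eq split: nat.splits)


section \<open>Schwartz functions\<close>

definition dir_deriv :: "'a::real_vector \<Rightarrow> ('a \<Rightarrow> complex) \<Rightarrow> 'a \<Rightarrow> complex" where
  "dir_deriv v f x = vector_derivative (\<lambda>s::real. f (x + s *\<^sub>R v)) (at 0)"

text \<open>
  The restriction of \<open>f\<close> to the finite-dimensional subspace \<open>V\<close> is a Schwartz function: all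
  iterated derivatives in directions from \<open>V\<close> exist and are continuous on \<open>V\<close>, and they decay
  faster than any power of the norm. For \<open>x \<in> V\<close> and directions in \<open>V\<close> only values of \<open>f\<close>
  on \<open>V\<close> enter.
\<close>

definition schwartz_on :: "'a::real_normed_vector set \<Rightarrow> ('a \<Rightarrow> complex) \<Rightarrow> bool" where
  "schwartz_on V f \<longleftrightarrow>
     (\<forall>vs. set vs \<subseteq> V \<longrightarrow>
        continuous_on V (fold dir_deriv vs f) \<and>
        (\<forall>v\<in>V. \<forall>x\<in>V. (\<lambda>s::real. fold dir_deriv vs f (x + s *\<^sub>R v)) differentiable (at 0)) \<and>
        (\<forall>k. \<exists>C. \<forall>x\<in>V. norm x ^ k * norm (fold dir_deriv vs f x) \<le> C))"

definition finite_dim_subspace :: "'a::real_vector set \<Rightarrow> bool" where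
  "finite_dim_subspace V \<longleftrightarrow> subspace V \<and> (\<exists>B. finite B \<and> span B = V)"

definition schwartz_space :: "('n::finite rminus \<Rightarrow> complex) set" where
  "schwartz_space = {f. \<forall>V. finite_dim_subspace V \<longrightarrow> schwartz_on V f}"

definition pi_t :: "('n::finite rminus \<Rightarrow> complex) \<Rightarrow> 'n rminus \<Rightarrow> complex" where
  "pi_t f x = (LINT y|lborel. f (seq_cons y x))"

definition eigenspace :: "complex \<Rightarrow> ('n::finite rminus \<Rightarrow> complex) set" where
  "eigenspace lam = {f \<in> schwartz_space. pi_t f = (\<lambda>x. lam * f x)}"

text \<open>The operator of partial differentiation with respect to \<open>x\<^sup>u\<^sub>-\<^sub>i\<close>.\<close>

definition partial :: "'n::finite \<Rightarrow> nat \<Rightarrow> ('n rminus \<Rightarrow> complex) \<Rightarrow> 'n rminus \<Rightarrow> complex" where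
  "partial u i = dir_deriv (basis_vec u i)"


section \<open>The affine Lie algebra\<close>

definition sl :: "(complex^'n^'n::finite) set" where
  "sl = {A. trace A = 0}"

definition mat_unit :: "'n::finite \<Rightarrow> 'n \<Rightarrow> complex^'n^'n" where
  "mat_unit u v = (\<chi> i j. if i = u \<and> j = v then 1 else 0)"

definition commutator :: "complex^'n^'n::finite \<Rightarrow> complex^'n^'n \<Rightarrow> complex^'n^'n" where
  "commutator A B = A ** B - B ** A"

text \<open>
  A pair \<open>(a, c)\<close> stands for \<open>\<Sum>\<^sub>m a\<^sub>m t\<^sup>m + c K\<close>; the affine algebra is the subspace
  where every \<open>a\<^sub>m\<close> is traceless.
\<close>

type_synonym 'n loop_ext = "(int, complex^'n^'n) poly_mapping \<times> complex"

definition affine_algebra :: "'n::finite loop_ext set" where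
  "affine_algebra = {X. \<forall>m. Poly_Mapping.lookup (fst X) m \<in> sl}"

definition loop :: "complex^'n^'n::finite \<Rightarrow> int \<Rightarrow> 'n loop_ext" where
  "loop A m = (Poly_Mapping.single m A, 0)"

definition central_K :: "'n::finite loop_ext" where
  "central_K = (0, 1)"

definition affine_scale :: "complex \<Rightarrow> 'n::finite loop_ext \<Rightarrow> 'n loop_ext" where
  "affine_scale c X = (Poly_Mapping.map (map_matrix ((*) c)) (fst X), c * snd X)"

text \<open>Bilinear extension of the defining brackets, with \<open>K\<close> central.\<close>

definition affine_bracket :: "'n::finite loop_ext \<Rightarrow> 'n loop_ext \<Rightarrow> 'n loop_ext" where
  "affine_bracket X Y =
     (let a = fst X; b = fst Y in
      (\<Sum>m\<in>Poly_Mapping.keys a. \<Sum>k\<in>Poly_Mapping.keys b.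
         Poly_Mapping.single (m + k)
           (commutator (Poly_Mapping.lookup a m) (Poly_Mapping.lookup b k)),
       \<Sum>m\<in>Poly_Mapping.keys a. \<Sum>k\<in>Poly_Mapping.keys b.
         if m + k = 0
         then of_int m * trace (Poly_Mapping.lookup a m ** Poly_Mapping.lookup b k)
         else 0))"

lemma affine_bracket_loop:
  "affine_bracket (loop (A :: complex^'n^'n::finite) m) (loop B k) =
     (Poly_Mapping.single (m + k) (commutator A B),
      if m + k = 0 then of_int m * trace (A ** B) else 0)"
proof -
  have [simp]: "0 ** M = 0" "M ** 0 = 0" for M :: "complex^'n^'n"
    by (simp_all add: matrix_matrix_mult_def vec_eq_iff)
  have [simp]: "trace (0 :: complex^'n^'n) = 0"
    by (simp add: trace_def)
  show ?thesis
    by (cases "A = 0"; cases "B = 0")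
       (simp_all add: affine_bracket_def loop_def commutator_def)
qed

lemma affine_bracket_closed: "affine_bracket X Y \<in> affine_algebra"
proof -
  have sl_comm: "commutator A B \<in> sl" for A B :: "complex^'a^'a"
    by (simp add: sl_def commutator_def trace_sub trace_mul_sym[of A B])
  have sl_0: "0 \<in> (sl :: (complex^'a^'a) set)"
    by (simp add: sl_def trace_def)
  have sl_sum: "(\<Sum>i\<in>I. g i) \<in> sl" if "\<And>i. i \<in> I \<Longrightarrow> g i \<in> sl"
    for g :: "int \<Rightarrow> complex^'a^'a" and I
    using that
    by (induction I rule: infinite_finite_induct) (auto simp: sl_0, auto simp: sl_def trace_add)
  show ?thesis
    unfolding affine_algebra_def affine_bracket_def Let_def
    by (auto simp: lookup_sum lookup_single when_def sl_0 intro!: sl_sum sl_comm)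
qed


section \<open>Operators on the eigenspace\<close>

type_synonym 'n affine_op = "'n loop_ext \<Rightarrow> ('n rminus \<Rightarrow> complex) \<Rightarrow> 'n rminus \<Rightarrow> complex"

definition endomorphism ::
  "complex \<Rightarrow> (('n::finite rminus \<Rightarrow> complex) \<Rightarrow> 'n rminus \<Rightarrow> complex) \<Rightarrow> bool" where
  "endomorphism lam T \<longleftrightarrow>
     (\<forall>f\<in>eigenspace lam. T f \<in> eigenspace lam) \<and>
     (\<forall>f\<in>eigenspace lam. \<forall>g\<in>eigenspace lam. T (\<lambda>x. f x + g x) = (\<lambda>x. T f x + T g x)) \<and>
     (\<forall>c. \<forall>f\<in>eigenspace lam. T (\<lambda>x. c * f x) = (\<lambda>x. c * T f x))"

definition affine_linear :: "complex \<Rightarrow> 'n::finite affine_op \<Rightarrow> bool" where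
  "affine_linear lam \<pi> \<longleftrightarrow>
     (\<forall>X\<in>affine_algebra. \<forall>Y\<in>affine_algebra. \<forall>f\<in>eigenspace lam.
        \<pi> (X + Y) f = (\<lambda>x. \<pi> X f x + \<pi> Y f x)) \<and>
     (\<forall>c. \<forall>X\<in>affine_algebra. \<forall>f\<in>eigenspace lam.
        \<pi> (affine_scale c X) f = (\<lambda>x. c * \<pi> X f x))"

definition has_central_charge :: "complex \<Rightarrow> 'n::finite affine_op \<Rightarrow> complex \<Rightarrow> bool" where
  "has_central_charge lam \<pi> c \<longleftrightarrow> (\<forall>f\<in>eigenspace lam. \<pi> central_K f = (\<lambda>x. c * f x))"

definition affine_representation :: "complex \<Rightarrow> 'n::finite affine_op \<Rightarrow> bool" where
  "affine_representation lam \<pi> \<longleftrightarrow>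
     (\<forall>X\<in>affine_algebra. endomorphism lam (\<pi> X)) \<and>
     affine_linear lam \<pi> \<and>
     (\<forall>X\<in>affine_algebra. \<forall>Y\<in>affine_algebra. \<forall>f\<in>eigenspace lam.
        \<pi> (affine_bracket X Y) f = (\<lambda>x. \<pi> X (\<pi> Y f) x - \<pi> Y (\<pi> X f) x))"

text \<open>
  In the sums over \<open>i\<close> below the index is \<open>Suc i\<close>, so that they range over \<open>1, 2, \<dots>\<close>; at each
  point only finitely many terms are nonzero.
\<close>

text \<open>The formula for \<open>E\<^sub>u\<^sub>v t\<^sup>j\<close>, \<open>j \<ge> 0\<close>; it makes sense also for \<open>u = v\<close>.\<close>

definition nonneg_op ::
  "'n::finite \<Rightarrow> 'n \<Rightarrow> nat \<Rightarrow> ('n rminus \<Rightarrow> complex) \<Rightarrow> 'n rminus \<Rightarrow> complex" where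
  "nonneg_op u v j f x =
     - (suminf (\<lambda>i. of_real (coord v (Suc i + j) x) * partial u (Suc i) f x))"

text \<open>
  \<open>\<pi>\<close> is the linear map with \<open>\<pi>(K) = 1\<close> and the prescribed values. That the operators
  preserve the eigenspace is not part of this definition but of \<^const>\<open>affine_representation\<close>.
\<close>

definition prescribed_action :: "complex \<Rightarrow> 'n::finite affine_op \<Rightarrow> bool" where
  "prescribed_action lam \<pi> \<longleftrightarrow>
     affine_linear lam \<pi> \<and>
     has_central_charge lam \<pi> 1 \<and>
     (\<forall>a\<in>sl. \<forall>j. \<forall>f\<in>eigenspace lam.
        \<pi> (loop a (int j)) f = (\<lambda>x. \<Sum>u\<in>UNIV. \<Sum>v\<in>UNIV. a $ u $ v * nonneg_op u v j f x)) \<and>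
     (\<forall>u v. \<forall>j>0. \<forall>f\<in>eigenspace lam. u \<noteq> v \<longrightarrow>
        \<pi> (loop (mat_unit u v) (- int j)) f =
          (\<lambda>x. - (lam powi (- int j)) *
             (pi_t ^^ j) (\<lambda>z. suminf (\<lambda>i. of_real (coord v (Suc i) z) * partial u (Suc i + j) f z)) x)) \<and>
     (\<forall>u v. \<forall>j>0. \<forall>f\<in>eigenspace lam. u \<noteq> v \<longrightarrow>
        \<pi> (loop (mat_unit u u - mat_unit v v) (- int j)) f =
          (\<lambda>x. - (lam powi (- int j)) *
             (pi_t ^^ j) (\<lambda>z. suminf (\<lambda>i. of_real (coord u (Suc i) z) * partial u (Suc i + j) f z
                                       - of_real (coord v (Suc i) z) * partial v (Suc i + j) f z)) x))"

end

theory Submission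
  imports Defs "HOL-Probability.Sinc_Integral"
begin

text \<open>
  Put \<open>T = \<lambda>\<^sup>-\<^sup>1 \<pi>\<^sub>t\<close>. The functions in question are the fixed points of \<open>T\<close>, so such an \<open>f\<close> may be
  replaced by \<open>T\<^sup>L f\<close> with \<open>L\<close> as large as desired: there is always room for \<open>L\<close> further variables
  that are integrated out in the end. For every integer \<open>k\<close> let \<open>R\<^sub>k\<close> be the vector field
  \<open>\<Sum>\<^sub>a x\<^sup>v\<^sub>-\<^sub>a\<^sub>-\<^sub>k \<partial>\<^sub>x\<^sup>u\<^sub>-\<^sub>a\<close>, where \<open>a \<ge> 1\<close> and \<open>a + k \<ge> 1\<close> (\<open>loop_field u v k\<close>). Then the operator that
  is prescribed for \<open>E\<^sub>u\<^sub>v t\<^sup>k\<close> is \<open>- T\<^sup>j R\<^sub>k\<close> with \<open>j = max 0 (- k)\<close>, for both signs of \<open>k\<close>.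

  Integration commutes with \<open>R\<^sub>k\<close> up to two error terms (\<open>pi_t_loop_field\<close>). One of them is a derivative
  that becomes a total derivative in an integration variable in the course of \<open>j\<close> further
  integrations, and so disappears. The other one is a scalar that occurs only for \<open>k = 0\<close> and \<open>u = v\<close>, and it cancels in
  traceless combinations. For such combinations, therefore, \<open>T\<^sup>N R\<^sub>k T\<^sup>M = T\<^sup>N\<^sup>+\<^sup>M R\<^sub>k\<close> for \<open>N \<ge> j\<close>
  (\<open>pi_t_pow_mat_field_pi_t_pow\<close>). This shows that the prescribed operators preserve the eigenspace,
  and that the product of two of them is \<open>T\<^sup>L R\<^sub>k R\<^sub>l\<close> for any large \<open>L\<close>.

  It remains to apply \<open>T\<^sup>L\<close> to the commutator of two vector fields. By the product rule the commutator is a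
  difference of fields of degree \<open>k + l\<close> whose sums over \<open>a\<close> start too late (\<open>loop_field_loop_field\<close>).
  Integration by parts shows that each missing term \<open>x\<^sup>v\<^sub>-\<^sub>a\<^sub>-\<^sub>k\<^sub>-\<^sub>l \<partial>\<^sub>x\<^sup>u\<^sub>-\<^sub>a\<close> contributes \<open>- 1\<close> if it
  contains a variable and its own derivative, and \<open>0\<close> otherwise. Counting the missing terms gives
  \<open>max 0 (- l) - max 0 (- k) = k\<close> when \<open>k + l = 0\<close>, which is the central term with \<open>K = 1\<close>
  (\<open>pi_t_pow_loop_field_commutator\<close>, \<open>loop_action_commutator\<close>).

  The analytic input is that the Schwartz space is stable under all operators that occur, that
  differentiation passes under the integral, that integrals of derivatives vanish and that partial
  derivatives commute. The infinite sums are harmless because on every finite-dimensional subspace only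
  finitely many summands are nonzero, and all operators are local enough to respect this
  (\<open>local_linear_Sum_any\<close>).

  Existence of the prescribed map is then a matter of writing it down (\<open>affine_action\<close>), and uniqueness
  holds because the elements on which it is prescribed span the affine algebra.
\<close>


section \<open>Finitely supported sequences\<close>

lemma lookup_scaleR:
  "Poly_Mapping.lookup (r *\<^sub>R x) k = r *\<^sub>R Poly_Mapping.lookup (x :: 'a \<Rightarrow>\<^sub>0 'b::real_vector) k"
proof -
  have "finite {i. r *\<^sub>R Poly_Mapping.lookup x i \<noteq> 0}"
    by (rule finite_subset[OF _ finite_lookup[of x]]) auto
  then show ?thesis
    by (simp add: scaleR_poly_mapping_def)
qed

text \<open>
  The subspaces \<open>level N\<close> are cofinal among all finite-dimensional subspaces, so that conditions on
  every finite-dimensional subspace need to be checked on them only.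
\<close>

definition level :: "nat \<Rightarrow> 'n::finite rminus set" where
  "level N = {x. \<forall>k\<ge>N. Poly_Mapping.lookup x k = 0}"

lemma level_mono: "M \<le> N \<Longrightarrow> level M \<subseteq> level N"
  by (auto simp: level_def)

lemma mem_level_mono: "x \<in> level M \<Longrightarrow> M \<le> N \<Longrightarrow> x \<in> level N"
  using level_mono by blast

lemma subspace_level: "subspace (level N)"
  by (auto simp: subspace_def level_def lookup_add lookup_scaleR)

lemma zero_mem_level [simp]: "0 \<in> level N"
  by (simp add: level_def)

lemma level_add: "x \<in> level N \<Longrightarrow> y \<in> level N \<Longrightarrow> x + y \<in> level N"
  by (rule subspace_add[OF subspace_level])

lemma level_scale: "x \<in> level N \<Longrightarrow> s *\<^sub>R x \<in> level N"
  by (rule subspace_scale[OF subspace_level])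

lemma ex_level: "\<exists>N. x \<in> level N"
proof -
  have "finite (Poly_Mapping.keys x)" by simp
  then obtain N where "\<And>k. k \<in> Poly_Mapping.keys x \<Longrightarrow> k < N"
    using finite_nat_set_iff_bounded by auto
  then show ?thesis
    by (intro exI[of _ N]) (force simp: level_def in_keys_iff)
qed

lemma finite_ex_level:
  assumes "finite B"
  shows "\<exists>N. B \<subseteq> level N"
  using assms
proof (induction rule: finite_induct)
  case (insert b B)
  then obtain N where "B \<subseteq> level N" by auto
  moreover obtain M where "b \<in> level M" using ex_level by blast
  ultimately have "insert b B \<subseteq> level (max N M)"
    using level_mono[of N "max N M"] level_mono[of M "max N M"] by auto
  then show ?case by blast
qed auto

lemma basis_vec_level [simp]: "basis_vec u (Suc i) \<in> level (Suc i)"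
  by (auto simp: basis_vec_def level_def lookup_single when_def)

lemma level_eq_sum:
  assumes "x \<in> level N"
  shows "x = (\<Sum>k<N. Poly_Mapping.single k (Poly_Mapping.lookup x k))"
proof (rule poly_mapping_eqI)
  fix j
  have "Poly_Mapping.lookup (\<Sum>k<N. Poly_Mapping.single k (Poly_Mapping.lookup x k)) j
      = (\<Sum>k<N. if k = j then Poly_Mapping.lookup x k else 0)"
    by (simp add: lookup_sum lookup_single when_def)
  also have "\<dots> = Poly_Mapping.lookup x j"
    using assms by (auto simp: level_def)
  finally show "Poly_Mapping.lookup x j
      = Poly_Mapping.lookup (\<Sum>k<N. Poly_Mapping.single k (Poly_Mapping.lookup x k)) j" by simp
qed

lemma single_eq_sum_basis_vec:
  "Poly_Mapping.single k y = (\<Sum>u\<in>UNIV. (y $ u) *\<^sub>R basis_vec u (Suc k))"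
  by (rule poly_mapping_eqI)
     (auto simp: lookup_sum lookup_scaleR basis_vec_def lookup_single when_def vec_eq_iff
        sum_component axis_def if_distrib cong: if_cong)

lemma finite_dim_level: "finite_dim_subspace (level N :: 'n::finite rminus set)"
  unfolding finite_dim_subspace_def
proof (intro conjI exI)
  let ?B = "(\<lambda>(u, k). basis_vec u (Suc k)) ` (UNIV \<times> {..<N}) :: 'n rminus set"
  show "subspace (level N :: 'n rminus set)" by (rule subspace_level)
  show "finite ?B" by simp
  have "?B \<subseteq> level N"
    using basis_vec_level mem_level_mono by (fastforce simp: Suc_le_eq)
  moreover have "x \<in> span ?B" if x: "x \<in> level N" for x :: "'n rminus"
  proof -
    have "(\<Sum>k<N. \<Sum>u\<in>UNIV. (Poly_Mapping.lookup x k $ u) *\<^sub>R basis_vec u (Suc k)) \<in> span ?B"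
      by (intro span_sum span_scale span_base) auto
    then show ?thesis
      using level_eq_sum[OF x] by (simp add: single_eq_sum_basis_vec)
  qed
  ultimately show "span ?B = level N"
    using span_minimal[OF _ subspace_level] by blast
qed

lemma finite_dim_subset_level:
  assumes "finite_dim_subspace V"
  shows "\<exists>N. V \<subseteq> level N"
proof -
  obtain B where B: "finite B" "span B = V"
    using assms by (auto simp: finite_dim_subspace_def)
  obtain N where "B \<subseteq> level N" using finite_ex_level[OF B(1)] by blast
  then have "span B \<subseteq> level N" by (intro span_minimal subspace_level)
  with B show ?thesis by blast
qed

lemma norm_eq_sum_lookup:
  assumes "x \<in> level N"
  shows "norm x = (\<Sum>k<N. norm (Poly_Mapping.lookup x k))"
proof -
  have "norm x = (\<Sum>k\<in>Poly_Mapping.keys x. norm (Poly_Mapping.lookup x k))"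
    by (simp add: norm_poly_mapping_def dist_poly_mapping_def)
  also have "\<dots> = (\<Sum>k<N. norm (Poly_Mapping.lookup x k))"
    using assms by (intro sum.mono_neutral_left) (auto simp: level_def in_keys_iff not_le[symmetric])
  finally show ?thesis .
qed

lemma norm_lookup_le: "norm (Poly_Mapping.lookup x k) \<le> norm (x :: 'n::finite rminus)"
proof -
  obtain N where "x \<in> level N" using ex_level by blast
  then have x: "x \<in> level (max N (Suc k))" by (rule mem_level_mono) simp
  show ?thesis
    unfolding norm_eq_sum_lookup[OF x] by (rule member_le_sum) auto
qed

lemma abs_coord_le: "\<bar>coord v i x\<bar> \<le> norm x"
  unfolding coord_def
  by (rule order_trans[OF component_le_norm_cart norm_lookup_le])

lemma coord_add: "coord v i (x + y) = coord v i x + coord v i y"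
  by (simp add: coord_def lookup_add)

lemma coord_scaleR: "coord v i (s *\<^sub>R x) = s * coord v i x"
  by (simp add: coord_def lookup_scaleR)

lemma bounded_linear_coord: "bounded_linear (coord v i)"
proof (rule bounded_linear_intro[where K = 1])
  show "norm (coord v i x) \<le> norm x * 1" for x
    using abs_coord_le[of v i x] by simp
qed (simp_all add: coord_add coord_scaleR)

lemma coord_basis_vec: "coord v (Suc i) (basis_vec u (Suc j)) = (if u = v \<and> i = j then 1 else 0)"
  by (auto simp: coord_def basis_vec_def lookup_single when_def axis_def)

lemma coord_level: "x \<in> level N \<Longrightarrow> N < i \<Longrightarrow> coord v i x = 0"
  by (simp add: coord_def level_def)

lemma lookup_seq_cons [simp]:
  "Poly_Mapping.lookup (seq_cons y x) 0 = y"
  "Poly_Mapping.lookup (seq_cons y x) (Suc k) = Poly_Mapping.lookup x k"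
  by (simp_all add: seq_cons.rep_eq)

lemma seq_cons_eqI:
  assumes "Poly_Mapping.lookup z 0 = y"
    and "\<And>k. Poly_Mapping.lookup z (Suc k) = Poly_Mapping.lookup x k"
  shows "seq_cons y x = z"
proof (rule poly_mapping_eqI)
  fix k show "Poly_Mapping.lookup (seq_cons y x) k = Poly_Mapping.lookup z k"
    using assms by (cases k) simp_all
qed

lemma seq_cons_add: "seq_cons (y + y') (x + x') = seq_cons y x + seq_cons y' x'"
  by (rule seq_cons_eqI) (simp_all add: lookup_add)

lemma seq_cons_diff: "seq_cons (y - y') (x - x') = seq_cons y x - seq_cons y' x'"
  by (rule seq_cons_eqI) (simp_all add: lookup_minus)

lemma seq_cons_scaleR: "seq_cons (s *\<^sub>R y) (s *\<^sub>R x) = s *\<^sub>R seq_cons y x"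
  by (rule seq_cons_eqI) (simp_all add: lookup_scaleR)

lemma seq_cons_level: "x \<in> level N \<Longrightarrow> seq_cons y x \<in> level (Suc N)"
  by (auto simp: level_def seq_cons.rep_eq split: nat.splits)

lemma norm_seq_cons: "norm (seq_cons y x) = norm y + norm x"
proof -
  obtain N where N: "x \<in> level N" using ex_level by blast
  show ?thesis
    unfolding norm_eq_sum_lookup[OF N] norm_eq_sum_lookup[OF seq_cons_level[OF N]]
    by (subst sum.lessThan_Suc_shift) simp
qed

lemma seq_cons_basis_vec_1: "seq_cons (axis u s) 0 = s *\<^sub>R basis_vec u (Suc 0)"
  by (rule seq_cons_eqI)
     (auto simp: basis_vec_def lookup_scaleR lookup_single when_def axis_def vec_eq_iff)

lemma seq_cons_basis_vec_Suc: "seq_cons 0 (basis_vec u (Suc i)) = basis_vec u (Suc (Suc i))"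
  by (rule seq_cons_eqI) (auto simp: basis_vec_def lookup_single when_def)

lemma continuous_on_seq_cons: "continuous_on A (\<lambda>y. seq_cons y x)"
proof (rule continuous_onI)
  fix y and e :: real assume "e > 0"
  have "dist (seq_cons y' x) (seq_cons y x) = dist y' y" for y'
    using seq_cons_diff[of y' y x x] by (simp add: dist_norm norm_seq_cons flip: seq_cons_diff)
  with \<open>e > 0\<close> show "\<exists>d>0. \<forall>x'\<in>A. dist x' y < d \<longrightarrow> dist (seq_cons x' x) (seq_cons y x) \<le> e"
    by (intro exI[of _ e]) auto
qed

lemma continuous_on_seq_cons_right: "continuous_on A (\<lambda>x. seq_cons y x)"
proof (rule continuous_onI)
  fix x :: "'a rminus" and e :: real assume "e > 0"
  have "dist (seq_cons y x') (seq_cons y x) = dist x' x" for x'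
    by (simp add: dist_norm norm_seq_cons flip: seq_cons_diff)
  with \<open>e > 0\<close> show "\<exists>d>0. \<forall>x'\<in>A. dist x' x < d \<longrightarrow> dist (seq_cons y x') (seq_cons y x) \<le> e"
    by (intro exI[of _ e]) auto
qed


section \<open>Closure properties of the Schwartz space\<close>

text \<open>
  This is the part of the Schwartz condition that does not involve higher derivatives. A function is
  Schwartz if and only if all its iterated directional derivatives are tame: any list of directions
  lies in some \<open>level N\<close>, and enlarging the subspace only strengthens the estimates.
\<close>

definition tame :: "('n::finite rminus \<Rightarrow> complex) \<Rightarrow> bool" where
  "tame g \<longleftrightarrow> (\<forall>N. continuous_on (level N) g) \<and>
     (\<forall>x v. (\<lambda>s::real. g (x + s *\<^sub>R v)) differentiable (at 0)) \<and>
     (\<forall>N k. \<exists>C. \<forall>x\<in>level N. norm x ^ k * norm (g x) \<le> C)"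

lemma schwartz_iff_tame: "f \<in> schwartz_space \<longleftrightarrow> (\<forall>vs. tame (fold dir_deriv vs f))"
proof
  assume f: "f \<in> schwartz_space"
  show "\<forall>vs. tame (fold dir_deriv vs f)"
  proof
    fix vs :: "'a rminus list"
    obtain N0 where N0: "set vs \<subseteq> level N0" using finite_ex_level[of "set vs"] by auto
    have S: "schwartz_on (level N) f" for N
      using f finite_dim_level by (auto simp: schwartz_space_def)
    note S' = S[unfolded schwartz_on_def, rule_format]
    have sub: "set vs \<subseteq> level (max N N0)" for N
      using N0 level_mono[of N0 "max N N0"] by auto
    have lev: "level N \<subseteq> level (max N N0)" for N
      by (rule level_mono) simp
    show "tame (fold dir_deriv vs f)"
      unfolding tame_def
    proof (intro conjI allI)
      fix N
      show "continuous_on (level N) (fold dir_deriv vs f)"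
        by (rule continuous_on_subset[OF _ lev]) (use S'[OF sub] in blast)
    next
      fix N k
      from S'[OF sub[of N]] obtain C
        where "\<forall>x\<in>level (max N N0). norm x ^ k * norm (fold dir_deriv vs f x) \<le> C" by blast
      with lev[of N] show "\<exists>C. \<forall>x\<in>level N. norm x ^ k * norm (fold dir_deriv vs f x) \<le> C" by blast
    next
      fix x v :: "'a rminus"
      obtain N where "{x, v} \<subseteq> level N" using finite_ex_level[of "{x, v}"] by auto
      then have "x \<in> level (max N N0)" "v \<in> level (max N N0)" using lev[of N] by auto
      then show "(\<lambda>s::real. fold dir_deriv vs f (x + s *\<^sub>R v)) differentiable (at 0)"
        using S'[OF sub[of N]] by blast
    qed
  qed
next
  assume t: "\<forall>vs. tame (fold dir_deriv vs f)"
  show "f \<in> schwartz_space"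
    unfolding schwartz_space_def schwartz_on_def mem_Collect_eq
  proof (intro allI impI conjI ballI)
    fix V :: "'a rminus set" and vs assume V: "finite_dim_subspace V"
    obtain N where N: "V \<subseteq> level N" using finite_dim_subset_level[OF V] by blast
    have *: "tame (fold dir_deriv vs f)" using t by blast
    then show "continuous_on V (fold dir_deriv vs f)"
      unfolding tame_def using N continuous_on_subset by blast
    show "(\<lambda>s::real. fold dir_deriv vs f (x + s *\<^sub>R v)) differentiable (at 0)" for x v
      using * unfolding tame_def by blast
    show "\<exists>C. \<forall>x\<in>V. norm x ^ k * norm (fold dir_deriv vs f x) \<le> C" for k
      using * N unfolding tame_def by (meson subsetD)
  qed
qed

lemma schwartz_tame: "f \<in> schwartz_space \<Longrightarrow> tame f"
  using schwartz_iff_tame[of f] by (metis fold_simps(1))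

lemma schwartz_dir_deriv: "f \<in> schwartz_space \<Longrightarrow> dir_deriv v f \<in> schwartz_space"
  using schwartz_iff_tame by (metis fold_simps(2))

text \<open>
  The Schwartz space is the largest set of tame functions that is closed under directional
  derivatives. All closure properties below are proved by exhibiting such a set.
\<close>

lemma schwartz_coinduct:
  assumes "f \<in> F"
    and "\<And>g. g \<in> F \<Longrightarrow> tame g"
    and "\<And>g v. g \<in> F \<Longrightarrow> dir_deriv v g \<in> F"
  shows "f \<in> schwartz_space"
proof -
  have "fold dir_deriv vs g \<in> F" if "g \<in> F" for vs g
    using that by (induction vs arbitrary: g) (simp_all add: assms(3))
  then show ?thesis
    using assms(1,2) by (simp add: schwartz_iff_tame)
qed

lemma tame_continuous: "tame g \<Longrightarrow> continuous_on (level N) g"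
  by (simp add: tame_def)

lemma tame_deriv_0:
  assumes "tame g"
  shows "((\<lambda>s. g (x + s *\<^sub>R v)) has_vector_derivative dir_deriv v g x) (at 0)"
  using assms unfolding tame_def dir_deriv_def by (simp flip: vector_derivative_works)

text \<open>
  Differentiability at \<open>0\<close> along every line gives differentiability along the whole line by moving
  the base point.
\<close>

lemma tame_deriv:
  assumes "tame g"
  shows "((\<lambda>s. g (x + s *\<^sub>R v)) has_vector_derivative dir_deriv v g (x + s *\<^sub>R v)) (at s within A)"
proof -
  have "((\<lambda>h. g ((x + s *\<^sub>R v) + h *\<^sub>R v)) has_vector_derivative dir_deriv v g (x + s *\<^sub>R v)) (at (s - s))"
    using tame_deriv_0[OF assms] by simp
  then have "((\<lambda>h. g ((x + s *\<^sub>R v) + h *\<^sub>R v)) \<circ> (\<lambda>r. r - s) has_vector_derivative 1 *\<^sub>R dir_deriv v g (x + s *\<^sub>R v)) (at s)"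
    by (intro vector_diff_chain_at) (auto intro!: derivative_eq_intros)
  then have "((\<lambda>s. g (x + s *\<^sub>R v)) has_vector_derivative dir_deriv v g (x + s *\<^sub>R v)) (at s)"
    by (simp add: o_def algebra_simps)
  then show ?thesis by (rule has_vector_derivative_at_within)
qed

lemma dir_derivI:
  "((\<lambda>s. g (x + s *\<^sub>R v)) has_vector_derivative d) (at 0) \<Longrightarrow> dir_deriv v g x = d"
  unfolding dir_deriv_def by (rule vector_derivative_at)

lemma tameI:
  assumes "\<And>N. continuous_on (level N) g"
    and "\<And>x v. ((\<lambda>s. g (x + s *\<^sub>R v)) has_vector_derivative d x v) (at 0)"
    and "\<And>N k. \<exists>C. \<forall>x\<in>level N. norm x ^ k * norm (g x) \<le> C"
  shows "tame g"
  using assms unfolding tame_def by (metis differentiableI_vector)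

text \<open>
  Powers of \<open>1 + norm x\<close> are submultiplicative under sums of vectors and bounded away from zero, which
  makes this form of the decay condition convenient for estimates.
\<close>

lemma tame_decay:
  assumes "tame g"
  obtains C where "C \<ge> 0" "\<And>x. x \<in> level N \<Longrightarrow> (1 + norm x) ^ k * norm (g x) \<le> C"
proof -
  from assms obtain C0 where C0: "\<And>x. x \<in> level N \<Longrightarrow> norm x ^ 0 * norm (g x) \<le> C0"
    unfolding tame_def by metis
  from assms obtain C1 where C1: "\<And>x. x \<in> level N \<Longrightarrow> norm x ^ k * norm (g x) \<le> C1"
    unfolding tame_def by metis
  have *: "(1 + norm x) ^ k * norm (g x) \<le> 2 ^ k * (C0 + C1)" if x: "x \<in> level N" for x
  proof -
    have "(1 + norm x) ^ k \<le> (2 * max 1 (norm x)) ^ k"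
      by (intro power_mono) auto
    also have "\<dots> = 2 ^ k * (max 1 (norm x)) ^ k" by (simp add: power_mult_distrib)
    also have "(max 1 (norm x)) ^ k \<le> 1 + norm x ^ k"
      by (cases "norm x \<le> 1") (auto simp: max_def)
    finally have "(1 + norm x) ^ k * norm (g x) \<le> 2 ^ k * (1 + norm x ^ k) * norm (g x)"
      by (intro mult_right_mono) auto
    also have "\<dots> = 2 ^ k * (norm x ^ 0 * norm (g x) + norm x ^ k * norm (g x))"
      by (simp add: algebra_simps)
    also have "\<dots> \<le> 2 ^ k * (C0 + C1)"
      using C0[OF x] C1[OF x] by (intro mult_left_mono add_mono) auto
    finally show ?thesis .
  qed
  have "0 \<le> 2 ^ k * (C0 + C1)"
    by (rule order_trans[OF _ *[of 0]]) auto
  with * show ?thesis by (intro that) auto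
qed

lemma tame_add:
  assumes f: "tame f" and g: "tame g"
  shows "tame (\<lambda>x. f x + g x)"
    and "dir_deriv v (\<lambda>x. f x + g x) = (\<lambda>x. dir_deriv v f x + dir_deriv v g x)"
proof -
  have d: "((\<lambda>s. f (x + s *\<^sub>R v) + g (x + s *\<^sub>R v)) has_vector_derivative
      dir_deriv v f x + dir_deriv v g x) (at 0)" for x v
    by (intro has_vector_derivative_add tame_deriv_0 f g)
  show "tame (\<lambda>x. f x + g x)"
  proof (rule tameI[OF _ d])
    fix N k
    obtain C where C: "\<And>x. x \<in> level N \<Longrightarrow> norm x ^ k * norm (f x) \<le> C"
      using f unfolding tame_def by metis
    obtain D where D: "\<And>x. x \<in> level N \<Longrightarrow> norm x ^ k * norm (g x) \<le> D"
      using g unfolding tame_def by metis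
    have "norm x ^ k * norm (f x + g x) \<le> C + D" if x: "x \<in> level N" for x
    proof -
      have "norm x ^ k * norm (f x + g x) \<le> norm x ^ k * (norm (f x) + norm (g x))"
        by (intro mult_left_mono norm_triangle_ineq) auto
      with C[OF x] D[OF x] show ?thesis by (simp add: algebra_simps)
    qed
    then show "\<exists>C. \<forall>x\<in>level N. norm x ^ k * norm (f x + g x) \<le> C" by blast
  qed (intro continuous_on_add tame_continuous f g)
  show "dir_deriv v (\<lambda>x. f x + g x) = (\<lambda>x. dir_deriv v f x + dir_deriv v g x)"
    using d by (intro ext dir_derivI)
qed

lemma tame_cmult:
  assumes f: "tame f"
  shows "tame (\<lambda>x. c * f x)"
    and "dir_deriv v (\<lambda>x. c * f x) = (\<lambda>x. c * dir_deriv v f x)"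
proof -
  have d: "((\<lambda>s. c * f (x + s *\<^sub>R v)) has_vector_derivative c * dir_deriv v f x) (at 0)" for x v
    by (intro has_vector_derivative_mult_right tame_deriv_0 f)
  show "tame (\<lambda>x. c * f x)"
  proof (rule tameI[OF _ d])
    fix N k
    obtain C where C: "\<And>x. x \<in> level N \<Longrightarrow> norm x ^ k * norm (f x) \<le> C"
      using f unfolding tame_def by metis
    have "norm x ^ k * norm (c * f x) \<le> norm c * C" if x: "x \<in> level N" for x
      using mult_left_mono[OF C[OF x], of "norm c"] by (simp add: norm_mult algebra_simps)
    then show "\<exists>C. \<forall>x\<in>level N. norm x ^ k * norm (c * f x) \<le> C" by blast
  qed (intro continuous_intros tame_continuous f)
  show "dir_deriv v (\<lambda>x. c * f x) = (\<lambda>x. c * dir_deriv v f x)"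
    using d by (intro ext dir_derivI)
qed

lemma tame_coord_mult:
  assumes f: "tame f"
  shows "tame (\<lambda>x. of_real (coord w i x) * f x)"
    and "dir_deriv v (\<lambda>x. of_real (coord w i x) * f x)
       = (\<lambda>x. of_real (coord w i v) * f x + of_real (coord w i x) * dir_deriv v f x)"
proof -
  have d: "((\<lambda>s. of_real (coord w i (x + s *\<^sub>R v)) * f (x + s *\<^sub>R v)) has_vector_derivative
       of_real (coord w i v) * f x + of_real (coord w i x) * dir_deriv v f x) (at 0)" for x v
  proof -
    have "((\<lambda>s. of_real (coord w i x + s * coord w i v)) has_vector_derivative
        complex_of_real (coord w i v)) (at 0)"
      by (rule has_vector_derivative_of_real) (auto intro!: derivative_eq_intros simp flip: has_real_derivative_iff_has_vector_derivative)
    from has_vector_derivative_mult[OF this tame_deriv_0[OF f, of x v]] show ?thesis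
      by (simp add: coord_add coord_scaleR add.commute)
  qed
  show "tame (\<lambda>x. of_real (coord w i x) * f x)"
  proof (rule tameI[OF _ d])
    show "continuous_on (level N) (\<lambda>x. of_real (coord w i x) * f x)" for N
      by (intro continuous_on_mult continuous_on_of_real tame_continuous f
            linear_continuous_on bounded_linear_coord)
    fix N k
    obtain C where C: "\<And>x. x \<in> level N \<Longrightarrow> norm x ^ Suc k * norm (f x) \<le> C"
      using f unfolding tame_def by metis
    have "norm x ^ k * norm (of_real (coord w i x) * f x) \<le> C" if x: "x \<in> level N" for x
    proof -
      have "norm x ^ k * norm (of_real (coord w i x) * f x)
          = norm x ^ k * \<bar>coord w i x\<bar> * norm (f x)"
        by (simp add: norm_mult)
      also have "\<dots> \<le> norm x ^ k * norm x * norm (f x)"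
        by (intro mult_right_mono mult_left_mono abs_coord_le) auto
      finally show ?thesis using C[OF x] by (simp add: algebra_simps)
    qed
    then show "\<exists>C. \<forall>x\<in>level N. norm x ^ k * norm (of_real (coord w i x) * f x) \<le> C" by blast
  qed
  show "dir_deriv v (\<lambda>x. of_real (coord w i x) * f x)
       = (\<lambda>x. of_real (coord w i v) * f x + of_real (coord w i x) * dir_deriv v f x)"
    using d by (intro ext dir_derivI)
qed

lemma schwartz_add:
  assumes "f \<in> schwartz_space" "g \<in> schwartz_space"
  shows "(\<lambda>x. f x + g x) \<in> schwartz_space"
proof (rule schwartz_coinduct)
  let ?F = "{\<lambda>x. f x + g x | f g. f \<in> schwartz_space \<and> g \<in> schwartz_space}"
  show "(\<lambda>x. f x + g x) \<in> ?F" using assms by blast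
  show "tame h" if "h \<in> ?F" for h using that by (auto intro: tame_add schwartz_tame)
  show "dir_deriv v h \<in> ?F" if h: "h \<in> ?F" for h v
  proof -
    obtain f g where fg: "h = (\<lambda>x. f x + g x)" "f \<in> schwartz_space" "g \<in> schwartz_space"
      using h by blast
    have "dir_deriv v h = (\<lambda>x. dir_deriv v f x + dir_deriv v g x)"
      unfolding fg(1) by (intro tame_add(2) schwartz_tame fg)
    then show ?thesis using fg(2,3) schwartz_dir_deriv by blast
  qed
qed

lemma schwartz_cmult:
  assumes "f \<in> schwartz_space"
  shows "(\<lambda>x. c * f x) \<in> schwartz_space"
proof (rule schwartz_coinduct)
  let ?F = "{\<lambda>x. c * f x | f. f \<in> schwartz_space}"
  show "(\<lambda>x. c * f x) \<in> ?F" using assms by blast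
  show "tame h" if "h \<in> ?F" for h using that by (auto intro: tame_cmult schwartz_tame)
  show "dir_deriv v h \<in> ?F" if h: "h \<in> ?F" for h v
  proof -
    obtain f where f: "h = (\<lambda>x. c * f x)" "f \<in> schwartz_space"
      using h by blast
    have "dir_deriv v h = (\<lambda>x. c * dir_deriv v f x)"
      unfolding f(1) by (intro tame_cmult(2) schwartz_tame f)
    then show ?thesis using f(2) schwartz_dir_deriv by blast
  qed
qed

lemma schwartz_zero: "(\<lambda>x. 0) \<in> schwartz_space"
proof (rule schwartz_coinduct[of _ "{\<lambda>x. 0}"])
  fix g :: "'a rminus \<Rightarrow> complex" and v :: "'a rminus"
  assume g: "g \<in> {\<lambda>x. 0}"
  then show "dir_deriv v g \<in> {\<lambda>x. 0}"
    by (auto simp: fun_eq_iff intro!: dir_derivI)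
  from g show "tame g" by (auto simp: tame_def)
qed auto

lemma schwartz_sum:
  "(\<And>i. i \<in> I \<Longrightarrow> h i \<in> schwartz_space) \<Longrightarrow> (\<lambda>x. \<Sum>i\<in>I. h i x) \<in> schwartz_space"
  by (induction I rule: infinite_finite_induct) (auto intro: schwartz_zero schwartz_add)

text \<open>
  By the product rule a derivative of \<open>x\<^sub>c f\<close> is again of the form \<open>g + x\<^sub>c f'\<close>, so the functions of
  this form are closed under differentiation.
\<close>

lemma schwartz_coord_mult:
  assumes "f \<in> schwartz_space"
  shows "(\<lambda>x. of_real (coord w i x) * f x) \<in> schwartz_space"
proof (rule schwartz_coinduct)
  let ?F = "{\<lambda>x. g x + of_real (coord w i x) * f x | f g. f \<in> schwartz_space \<and> g \<in> schwartz_space}"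
  show "(\<lambda>x. of_real (coord w i x) * f x) \<in> ?F"
    using assms schwartz_zero by (intro CollectI exI[of _ f] exI[of _ "\<lambda>x. 0"]) simp
  show "tame h" if "h \<in> ?F" for h
    using that by clarify (intro tame_add tame_coord_mult schwartz_tame)
  show "dir_deriv v h \<in> ?F" if h: "h \<in> ?F" for h v
  proof -
    obtain f g where fg: "h = (\<lambda>x. g x + of_real (coord w i x) * f x)"
      "f \<in> schwartz_space" "g \<in> schwartz_space" using h by blast
    have "dir_deriv v h = (\<lambda>x. dir_deriv v g x
        + (of_real (coord w i v) * f x + of_real (coord w i x) * dir_deriv v f x))"
      unfolding fg(1) using fg(2,3)
      by (simp add: tame_add(2) tame_coord_mult schwartz_tame)
    also have "\<dots> = (\<lambda>x. (dir_deriv v g x + of_real (coord w i v) * f x)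
        + of_real (coord w i x) * dir_deriv v f x)"
      by (simp add: add.assoc)
    finally show ?thesis
      by (intro CollectI exI[of _ "dir_deriv v f"]
        exI[of _ "\<lambda>x. dir_deriv v g x + of_real (coord w i v) * f x"] conjI
        schwartz_dir_deriv schwartz_add schwartz_cmult fg(2,3)) simp
  qed
qed

lemma dir_deriv_level_cong:
  assumes "\<And>x. x \<in> level N \<Longrightarrow> f x = g x" "x \<in> level N" "v \<in> level N"
  shows "dir_deriv v f x = dir_deriv v g x"
proof -
  have "(\<lambda>s. f (x + s *\<^sub>R v)) = (\<lambda>s. g (x + s *\<^sub>R v))"
    using assms by (auto intro!: level_add level_scale)
  then show ?thesis by (simp add: dir_deriv_def)
qed

text \<open>
  Values on \<open>level N\<close> determine all derivatives in directions from \<open>level N\<close>. Therefore a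
  function that agrees on each \<open>level N\<close> with some Schwartz function, which may depend on \<open>N\<close>, is a
  Schwartz function. This applies to infinite sums that are finite on every level.
\<close>

lemma schwartz_local:
  assumes "\<And>N. \<exists>g\<in>schwartz_space. \<forall>x\<in>level N. f x = g x"
  shows "f \<in> schwartz_space"
proof (rule schwartz_coinduct)
  let ?F = "{f. \<forall>N. \<exists>g\<in>schwartz_space. \<forall>x\<in>level N. f x = g x}"
  show "f \<in> ?F" using assms by blast
next
  fix f :: "'a rminus \<Rightarrow> complex" assume f: "f \<in> {f. \<forall>N. \<exists>g\<in>schwartz_space. \<forall>x\<in>level N. f x = g x}"
  show "tame f"
    unfolding tame_def
  proof (intro conjI allI)
    fix N
    from f obtain g where g: "g \<in> schwartz_space" "\<And>x. x\<in>level N \<Longrightarrow> f x = g x" by blast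
    show "continuous_on (level N) f"
      using tame_continuous[OF schwartz_tame[OF g(1)]] g(2) by (simp cong: continuous_on_cong)
    fix k
    from schwartz_tame[OF g(1)] obtain C where "\<forall>x\<in>level N. norm x ^ k * norm (g x) \<le> C"
      unfolding tame_def by metis
    with g(2) show "\<exists>C. \<forall>x\<in>level N. norm x ^ k * norm (f x) \<le> C" by auto
  next
    fix x v :: "'a rminus"
    obtain N where N: "{x, v} \<subseteq> level N" using finite_ex_level[of "{x, v}"] by auto
    from f obtain g where g: "g \<in> schwartz_space" "\<And>x. x\<in>level N \<Longrightarrow> f x = g x" by blast
    have "(\<lambda>s. f (x + s *\<^sub>R v)) = (\<lambda>s. g (x + s *\<^sub>R v))"
      using N g(2) by (auto intro!: level_add level_scale)
    then show "(\<lambda>s::real. f (x + s *\<^sub>R v)) differentiable (at 0)"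
      using schwartz_tame[OF g(1)] by (simp add: tame_def)
  qed
next
  fix f :: "'a rminus \<Rightarrow> complex" and v
  assume f: "f \<in> {f. \<forall>N. \<exists>g\<in>schwartz_space. \<forall>x\<in>level N. f x = g x}"
  show "dir_deriv v f \<in> {f. \<forall>N. \<exists>g\<in>schwartz_space. \<forall>x\<in>level N. f x = g x}"
  proof (intro CollectI allI)
    fix N
    obtain M where M: "v \<in> level M" using ex_level by blast
    from f obtain g where g: "g \<in> schwartz_space" "\<And>x. x\<in>level (max N M) \<Longrightarrow> f x = g x" by blast
    have "dir_deriv v f x = dir_deriv v g x" if "x \<in> level N" for x
      using g(2) by (rule dir_deriv_level_cong) (auto intro: mem_level_mono[OF that] mem_level_mono[OF M])
    then show "\<exists>g\<in>schwartz_space. \<forall>x\<in>level N. dir_deriv v f x = g x"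
      using schwartz_dir_deriv[OF g(1)] by blast
  qed
qed


section \<open>Integration over the first coordinate\<close>

text \<open>
  An integrable majorant that decays only polynomially, so that every Schwartz function is dominated
  by a multiple of it. The product form reduces integrability to the real line.
\<close>

definition weight :: "'a::euclidean_space \<Rightarrow> real" where
  "weight y = (\<Prod>b\<in>Basis. inverse (1 + (y \<bullet> b)\<^sup>2))"

lemma weight_nonneg: "weight y \<ge> 0"
  unfolding weight_def by (intro prod_nonneg) (simp add: add_nonneg_nonneg)

lemma integrable_weight: "integrable lborel (weight :: 'a::euclidean_space \<Rightarrow> real)"
proof -
  have one: "integrable lborel (\<lambda>x::real. inverse (1 + x\<^sup>2))"
    using integrable_inverse_1_plus_square by (simp add: set_integrable_def einterval_def)
  interpret product_sigma_finite "\<lambda>b::'a. lborel :: real measure" ..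
  have "integrable (\<Pi>\<^sub>M b\<in>(Basis :: 'a set). lborel)
      (\<lambda>f. \<Prod>b\<in>(Basis :: 'a set). inverse (1 + (f b)\<^sup>2 :: real))"
    by (intro product_integrable_prod one) auto
  moreover have "weight (\<Sum>b\<in>Basis. f b *\<^sub>R b) = (\<Prod>b\<in>(Basis :: 'a set). inverse (1 + (f b)\<^sup>2))" for f
    by (simp add: weight_def)
  moreover have "(weight :: 'a \<Rightarrow> real) \<in> borel_measurable borel"
    unfolding weight_def by measurable
  ultimately show ?thesis
    by (subst lborel_eq) (simp add: integrable_distr_eq)
qed

lemma weight_lower_bound: "1 \<le> (1 + norm y) ^ (2 * DIM('a)) * weight (y :: 'a::euclidean_space)"
proof -
  have "(\<Prod>b\<in>(Basis::'a set). 1 + (y \<bullet> b)\<^sup>2) \<le> (\<Prod>b\<in>(Basis::'a set). (1 + norm y)\<^sup>2)"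
  proof (intro prod_mono conjI)
    fix b :: 'a assume "b \<in> Basis"
    then have "\<bar>y \<bullet> b\<bar> \<le> norm y" by (rule Basis_le_norm)
    then have "\<bar>y \<bullet> b\<bar>\<^sup>2 \<le> (norm y)\<^sup>2" by (intro power_mono) auto
    then have "(y \<bullet> b)\<^sup>2 \<le> (norm y)\<^sup>2 + 2 * norm y"
      by (simp add: add_increasing2 del: power2_norm_eq_inner)
    then show "1 + (y \<bullet> b)\<^sup>2 \<le> (1 + norm y)\<^sup>2"
      by (simp add: power2_sum)
  qed (simp add: add_nonneg_nonneg)
  also have "\<dots> = (1 + norm y) ^ (2 * DIM('a))" by (simp add: power_mult)
  finally have *: "(\<Prod>b\<in>(Basis::'a set). 1 + (y \<bullet> b)\<^sup>2) \<le> (1 + norm y) ^ (2 * DIM('a))" .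
  have "0 < (\<Prod>b\<in>(Basis::'a set). 1 + (y \<bullet> b)\<^sup>2)"
    by (intro prod_pos) (simp add: add_pos_nonneg)
  moreover have "weight y = inverse (\<Prod>b\<in>(Basis::'a set). 1 + (y \<bullet> b)\<^sup>2)"
    using prod_inversef[of "\<lambda>b. 1 + (y \<bullet> b)\<^sup>2" Basis] by (simp only: weight_def o_def)
  ultimately have "(\<Prod>b\<in>(Basis::'a set). 1 + (y \<bullet> b)\<^sup>2) * weight y = 1"
    by (metis less_irrefl right_inverse)
  then show ?thesis
    using mult_right_mono[OF * weight_nonneg[of y]] by simp
qed

text \<open>
  The norm of \<open>seq_cons y x\<close> is \<open>norm y + norm x\<close>, so part of the decay of \<open>g\<close> can be spent on
  integrability in \<open>y\<close> and the rest on decay in \<open>x\<close>, uniformly.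
\<close>

lemma tame_weight_bound:
  fixes g :: "'n::finite rminus \<Rightarrow> complex"
  assumes "tame g"
  obtains C where "C \<ge> 0"
    "\<And>x y. x \<in> level N \<Longrightarrow> (1 + norm x) ^ k * norm (g (seq_cons y x)) \<le> C * weight y"
proof -
  let ?d = "2 * DIM(real^'n)"
  obtain C where C: "C \<ge> 0"
    "\<And>z. z \<in> level (Suc N) \<Longrightarrow> (1 + norm z) ^ (k + ?d) * norm (g z) \<le> C"
    using tame_decay[OF assms] by blast
  show ?thesis
  proof (rule that[OF C(1)])
    fix x y assume x: "x \<in> (level N :: 'n rminus set)"
    let ?z = "seq_cons y x"
    have "(1 + norm x) ^ k * norm (g ?z)
        \<le> (1 + norm x) ^ k * norm (g ?z) * ((1 + norm y) ^ ?d * weight y)"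
      using mult_left_mono[OF weight_lower_bound[of y], of "(1 + norm x) ^ k * norm (g ?z)"] by simp
    also have "\<dots> = ((1 + norm x) ^ k * (1 + norm y) ^ ?d * norm (g ?z)) * weight y"
      by (simp only: mult_ac)
    also have "\<dots> \<le> ((1 + norm ?z) ^ k * (1 + norm ?z) ^ ?d * norm (g ?z)) * weight y"
      by (intro mult_right_mono mult_mono power_mono) (auto simp: norm_seq_cons weight_nonneg)
    also have "\<dots> \<le> C * weight y"
      using C(2)[OF seq_cons_level[OF x, of y]]
      by (intro mult_right_mono) (auto simp: power_add weight_nonneg)
    finally show "(1 + norm x) ^ k * norm (g ?z) \<le> C * weight y" .
  qed
qed

lemma tame_measurable:
  assumes "tame g"
  shows "(\<lambda>y. g (seq_cons y x)) \<in> borel_measurable borel"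
proof -
  obtain N where "x \<in> level N" using ex_level by blast
  then have "continuous_on UNIV (\<lambda>y. g (seq_cons y x))"
    by (intro continuous_on_compose2[OF tame_continuous[OF assms, of "Suc N"]]
        continuous_on_seq_cons) (auto intro: seq_cons_level)
  then show ?thesis by (rule borel_measurable_continuous_onI)
qed

lemma tame_integrable:
  assumes "tame g"
  shows "integrable lborel (\<lambda>y. g (seq_cons y x))"
proof -
  obtain N where N: "x \<in> level N" using ex_level by blast
  obtain C where C: "\<And>x y. x \<in> level N \<Longrightarrow> (1 + norm x) ^ 0 * norm (g (seq_cons y x)) \<le> C * weight y"
    using tame_weight_bound[OF assms] by metis
  show ?thesis
  proof (rule Bochner_Integration.integrable_bound)
    show "integrable lborel (\<lambda>y::real^'a. C * weight y)"
      using integrable_weight by (rule integrable_mult_right)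
    show "AE y in lborel. norm (g (seq_cons y x)) \<le> norm (C * weight y)"
      using C[OF N] by (intro AE_I2) (force intro: order_trans[OF _ abs_ge_self])
  qed (use tame_measurable[OF assms] in simp)
qed

lemma continuous_on_pi_t:
  fixes g :: "'n::finite rminus \<Rightarrow> complex"
  assumes g: "tame g"
  shows "continuous_on (level N) (pi_t g)"
  unfolding continuous_on_sequentially
proof (intro allI ballI impI)
  fix X and a :: "'n rminus" assume a: "a \<in> level N" and "(\<forall>n. X n \<in> level N) \<and> X \<longlonglongrightarrow> a"
  then have X: "\<And>n. X n \<in> level N" "X \<longlonglongrightarrow> a" by auto
  obtain C where C: "\<And>x y. x \<in> level N \<Longrightarrow> (1 + norm x) ^ 0 * norm (g (seq_cons y x)) \<le> C * weight y"
    using tame_weight_bound[OF g] by metis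
  have lim: "(\<lambda>n. g (seq_cons y (X n))) \<longlonglongrightarrow> g (seq_cons y a)" for y
  proof -
    have "continuous_on (level N) (\<lambda>x. g (seq_cons y x))"
      by (intro continuous_on_compose2[OF tame_continuous[OF g, of "Suc N"]]
          continuous_on_seq_cons_right) (auto intro: seq_cons_level)
    then show ?thesis
      using X a unfolding continuous_on_sequentially by (auto simp: o_def)
  qed
  have "(\<lambda>n. LINT y|lborel. g (seq_cons y (X n))) \<longlonglongrightarrow> (LINT y|lborel. g (seq_cons y a))"
  proof (rule integral_dominated_convergence[where w = "\<lambda>y. C * weight y"])
    show "integrable lborel (\<lambda>y::real^'n. C * weight y)"
      using integrable_weight by (rule integrable_mult_right)
    show "AE y in lborel. (\<lambda>n. g (seq_cons y (X n))) \<longlonglongrightarrow> g (seq_cons y a)"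
      using lim by simp
    show "AE y in lborel. norm (g (seq_cons y (X n))) \<le> C * weight y" for n
      using C[OF X(1)] by simp
  qed (use tame_measurable[OF g] in simp_all)
  then show "(pi_t g \<circ> X) \<longlonglongrightarrow> pi_t g a"
    by (simp add: o_def pi_t_def)
qed

lemma pi_t_decay:
  assumes g: "tame g"
  shows "\<exists>C. \<forall>x\<in>level N. norm x ^ k * norm (pi_t g x) \<le> C"
proof -
  obtain C where C: "\<And>x y. x \<in> level N \<Longrightarrow> (1 + norm x) ^ k * norm (g (seq_cons y x)) \<le> C * weight y"
    using tame_weight_bound[OF g] by metis
  have "norm x ^ k * norm (pi_t g x) \<le> (LINT y|lborel. C * weight (y :: real^'a))"
    if x: "x \<in> level N" for x
  proof -
    have "norm x ^ k * norm (pi_t g x) \<le> norm x ^ k * (LINT y|lborel. norm (g (seq_cons y x)))"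
      unfolding pi_t_def by (intro mult_left_mono integral_norm_bound) auto
    also have "\<dots> = (LINT y|lborel. norm x ^ k * norm (g (seq_cons y x)))"
      by simp
    also have "\<dots> \<le> (LINT y|lborel. C * weight (y :: real^'a))"
    proof (rule integral_mono)
      show "integrable lborel (\<lambda>y. norm x ^ k * norm (g (seq_cons y x)))"
        by (intro integrable_mult_right integrable_norm tame_integrable g)
      show "integrable lborel (\<lambda>y::real^'a. C * weight y)"
        using integrable_weight by (rule integrable_mult_right)
      show "norm x ^ k * norm (g (seq_cons y x)) \<le> C * weight y" for y
        by (rule order_trans[OF _ C[OF x]]) (intro mult_right_mono power_mono, auto)
    qed
    finally show ?thesis .
  qed
  then show ?thesis by blast
qed

lemma has_vector_derivative_at_0_iff:
  "(F has_vector_derivative d) (at 0) \<longleftrightarrow> ((\<lambda>s. (F s - F 0) /\<^sub>R s) \<longlongrightarrow> d) (at 0)"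
proof -
  have "norm (F s - F 0 - s *\<^sub>R d) / norm s = norm ((F s - F 0) /\<^sub>R s - d)" if "s \<noteq> 0" for s
  proof -
    have "(F s - F 0) /\<^sub>R s - d = (F s - F 0 - s *\<^sub>R d) /\<^sub>R s"
      using that by (simp add: scaleR_diff_right)
    then show ?thesis by (simp add: divide_inverse_commute)
  qed
  then have "((\<lambda>s. norm (F s - F 0 - s *\<^sub>R d) / norm s) \<longlongrightarrow> 0) (at 0)
      \<longleftrightarrow> ((\<lambda>s. norm ((F s - F 0) /\<^sub>R s - d)) \<longlongrightarrow> 0) (at 0)"
    by (intro filterlim_cong) (auto simp: eventually_at_filter)
  also have "\<dots> \<longleftrightarrow> ((\<lambda>s. (F s - F 0) /\<^sub>R s) \<longlongrightarrow> d) (at 0)"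
    by (subst tendsto_norm_zero_iff) (rule LIM_zero_iff)
  finally show ?thesis
    by (simp add: has_vector_derivative_def has_derivative_at bounded_linear_scaleR_left)
qed

text \<open>
  Differentiation under the integral sign. The direction \<open>v\<close> may have a component in the integration
  variable; the case in which it has no other component yields that integrals of derivatives vanish.
\<close>

lemma has_vector_derivative_integral:
  assumes g: "tame g" and dg: "tame (dir_deriv v g)"
  shows "((\<lambda>s. LINT y|lborel. g (seq_cons y x + s *\<^sub>R v))
      has_vector_derivative (LINT y|lborel. dir_deriv v g (seq_cons y x))) (at 0)"
proof -
  obtain N where N: "{x, v} \<subseteq> level N" using finite_ex_level[of "{x, v}"] by auto
  let ?d = "2 * DIM(real^'a)"
  obtain C where C: "C \<ge> 0"
    "\<And>z. z \<in> level (Suc N) \<Longrightarrow> (1 + norm z) ^ ?d * norm (dir_deriv v g z) \<le> C"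
    using tame_decay[OF dg] by blast
  have lev: "seq_cons y x + s *\<^sub>R v \<in> level (Suc N)" for y s
    using N by (intro level_add level_scale seq_cons_level) (auto intro: mem_level_mono)
  define w where "w = (\<lambda>y :: real^'a. C * (1 + norm v) ^ ?d * weight y)"
  \<comment> \<open>The majorant must not depend on \<open>s\<close>; moving the point by \<open>s *\<^sub>R v\<close> costs a factor \<open>(1 + norm v) ^ ?d\<close>.\<close>
  have bound: "norm (dir_deriv v g (seq_cons y x + s *\<^sub>R v)) \<le> w y" if s: "\<bar>s\<bar> \<le> 1" for y s
  proof -
    let ?z = "seq_cons y x + s *\<^sub>R v"
    have "norm (seq_cons y x) \<le> norm ?z + norm (s *\<^sub>R v)"
      using norm_triangle_ineq4[of ?z "s *\<^sub>R v"] by simp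
    moreover have "norm (s *\<^sub>R v) \<le> norm v"
      using s by (simp add: mult_left_le_one_le)
    ultimately have "norm y \<le> norm ?z + norm v"
      using norm_seq_cons[of y x] by (smt (verit) norm_ge_zero)
    moreover have "(1 + norm ?z) * (1 + norm v) = 1 + norm ?z + norm v + norm ?z * norm v"
      by (simp add: algebra_simps)
    moreover have "0 \<le> norm ?z * norm v" by simp
    ultimately have y: "1 + norm y \<le> (1 + norm ?z) * (1 + norm v)"
      by linarith
    have "norm (dir_deriv v g ?z) \<le> norm (dir_deriv v g ?z) * ((1 + norm y) ^ ?d * weight y)"
      using mult_left_mono[OF weight_lower_bound[of y], of "norm (dir_deriv v g ?z)"] by simp
    also have "\<dots> \<le> norm (dir_deriv v g ?z) * (((1 + norm ?z) * (1 + norm v)) ^ ?d * weight y)"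
      by (intro mult_left_mono mult_right_mono power_mono y) (auto simp: weight_nonneg)
    also have "\<dots> = ((1 + norm ?z) ^ ?d * norm (dir_deriv v g ?z)) * ((1 + norm v) ^ ?d * weight y)"
      by (simp only: power_mult_distrib mult_ac)
    also have "\<dots> \<le> C * ((1 + norm v) ^ ?d * weight y)"
      by (intro mult_right_mono C lev) (auto simp: weight_nonneg)
    finally show ?thesis by (simp add: w_def mult.assoc)
  qed
  have w: "integrable lborel w"
    unfolding w_def using integrable_weight by (rule integrable_mult_right)
  \<comment> \<open>The mean value inequality carries the bound over to the difference quotients.\<close>
  have quot: "norm (g (seq_cons y x + s *\<^sub>R v) - g (seq_cons y x)) \<le> w y * \<bar>s\<bar>"
    if s: "\<bar>s\<bar> \<le> 1" for y s
  proof -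
    have "norm (g (seq_cons y x + s *\<^sub>R v) - g (seq_cons y x + 0 *\<^sub>R v)) \<le> w y * norm (s - 0)"
    proof (rule differentiable_bound[where S = "{-1..1}"
          and f' = "\<lambda>r h. h *\<^sub>R dir_deriv v g (seq_cons y x + r *\<^sub>R v)"])
      fix r :: real assume r: "r \<in> {-1..1}"
      show "((\<lambda>r. g (seq_cons y x + r *\<^sub>R v)) has_derivative
          (\<lambda>h. h *\<^sub>R dir_deriv v g (seq_cons y x + r *\<^sub>R v))) (at r within {-1..1})"
        using tame_deriv[OF g] unfolding has_vector_derivative_def .
      show "onorm (\<lambda>h. h *\<^sub>R dir_deriv v g (seq_cons y x + r *\<^sub>R v)) \<le> w y"
        using bound[of r y] r by (intro onorm_le) (auto simp: mult_ac intro!: mult_left_mono)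
    qed (use s in auto)
    then show ?thesis by simp
  qed
  have meas: "(\<lambda>y. g (seq_cons y x + s *\<^sub>R v)) \<in> borel_measurable borel" for s
  proof -
    have "continuous_on UNIV (\<lambda>y. g (seq_cons y x + s *\<^sub>R v))"
      by (intro continuous_on_compose2[OF tame_continuous[OF g, of "Suc N"]] continuous_on_add
          continuous_on_seq_cons continuous_on_const) (use lev in auto)
    then show ?thesis by (rule borel_measurable_continuous_onI)
  qed
  have int0: "integrable lborel (\<lambda>y. g (seq_cons y x))" by (rule tame_integrable[OF g])
  have int: "integrable lborel (\<lambda>y. g (seq_cons y x + s *\<^sub>R v))" if s: "\<bar>s\<bar> \<le> 1" for s
  proof -
    have "integrable lborel (\<lambda>y. g (seq_cons y x + s *\<^sub>R v) - g (seq_cons y x))"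
    proof (rule Bochner_Integration.integrable_bound[OF integrable_mult_left[OF w]])
      show "AE y in lborel. norm (g (seq_cons y x + s *\<^sub>R v) - g (seq_cons y x)) \<le> norm (w y * \<bar>s\<bar>)"
        using quot[OF s] by (intro AE_I2) (force intro: order_trans[OF _ abs_ge_self])
    qed (use meas[of s] meas[of 0] in simp)
    from Bochner_Integration.integrable_add[OF this int0] show ?thesis by simp
  qed
  let ?I = "\<lambda>s. LINT y|lborel. g (seq_cons y x + s *\<^sub>R v)"
  let ?D = "LINT y|lborel. dir_deriv v g (seq_cons y x)"
  have *: "((\<lambda>s. (?I s - ?I 0) /\<^sub>R s) \<longlongrightarrow> ?D) (at 0 within {-1<..<1})"
    unfolding tendsto_at_iff_sequentially
  proof (intro allI impI)
    fix X :: "nat \<Rightarrow> real"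
    assume X: "\<forall>i. X i \<in> {-1<..<1} - {0}" "X \<longlonglongrightarrow> 0"
    have X1: "\<bar>X i\<bar> \<le> 1" "X i \<noteq> 0" for i using X(1)[rule_format, of i] by auto
    have "(\<lambda>i. LINT y|lborel. (g (seq_cons y x + X i *\<^sub>R v) - g (seq_cons y x)) /\<^sub>R X i) \<longlonglongrightarrow> ?D"
    proof (rule integral_dominated_convergence[OF _ _ w])
      show "AE y in lborel. (\<lambda>i. (g (seq_cons y x + X i *\<^sub>R v) - g (seq_cons y x)) /\<^sub>R X i)
          \<longlonglongrightarrow> dir_deriv v g (seq_cons y x)"
      proof (rule AE_I2)
        fix y
        have "((\<lambda>s. (g (seq_cons y x + s *\<^sub>R v) - g (seq_cons y x)) /\<^sub>R s) \<longlongrightarrow> dir_deriv v g (seq_cons y x)) (at 0)"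
          using tame_deriv_0[OF g, of "seq_cons y x" v]
          by (simp add: has_vector_derivative_at_0_iff)
        then show "(\<lambda>i. (g (seq_cons y x + X i *\<^sub>R v) - g (seq_cons y x)) /\<^sub>R X i)
          \<longlonglongrightarrow> dir_deriv v g (seq_cons y x)"
          using X X1 unfolding tendsto_at_iff_sequentially by (auto simp: o_def)
      qed
      show "AE y in lborel. norm ((g (seq_cons y x + X i *\<^sub>R v) - g (seq_cons y x)) /\<^sub>R X i) \<le> w y" for i
      proof (rule AE_I2)
        fix y
        have "norm (a /\<^sub>R X i) = norm a / \<bar>X i\<bar>" for a :: complex
          by (simp add: divide_inverse_commute)
        then show "norm ((g (seq_cons y x + X i *\<^sub>R v) - g (seq_cons y x)) /\<^sub>R X i) \<le> w y"
          using quot[OF X1(1), of y i] X1(2)[of i] by (simp add: pos_divide_le_eq del: abs_divide)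
      qed
      show "(\<lambda>y. (g (seq_cons y x + X i *\<^sub>R v) - g (seq_cons y x)) /\<^sub>R X i) \<in> borel_measurable lborel" for i
        using meas[of "X i"] meas[of 0] by simp
    qed (use tame_measurable[OF dg] in simp)
    moreover have "(LINT y|lborel. (g (seq_cons y x + X i *\<^sub>R v) - g (seq_cons y x)) /\<^sub>R X i)
        = (?I (X i) - ?I 0) /\<^sub>R X i" for i
      using int[OF X1(1), of i] int0 
      by (simp only: integral_scaleR_right Bochner_Integration.integral_diff scaleR_zero_left add_0_right)
    ultimately show "((\<lambda>s. (?I s - ?I 0) /\<^sub>R s) \<circ> X) \<longlonglongrightarrow> ?D"
      by (simp only: o_def)
  qed
  have "((\<lambda>s. (?I s - ?I 0) /\<^sub>R s) \<longlongrightarrow> ?D) (at 0)"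
    using * by (subst (asm) at_within_open) auto
  then show ?thesis
    by (simp add: has_vector_derivative_at_0_iff)
qed

text \<open>
  Directions in the remaining variables: a derivative of the integral is the integral of the
  derivative in the shifted direction.
\<close>

lemma dir_deriv_pi_t:
  assumes "tame g" "tame (dir_deriv (seq_cons 0 v) g)"
  shows "((\<lambda>s. pi_t g (x + s *\<^sub>R v)) has_vector_derivative
     pi_t (dir_deriv (seq_cons 0 v) g) x) (at 0)"
proof -
  have "seq_cons y x + s *\<^sub>R seq_cons 0 v = seq_cons y (x + s *\<^sub>R v)" for y :: "real^'a" and s
    using seq_cons_add[of y 0 x "s *\<^sub>R v"] seq_cons_scaleR[of s 0 v] by simp
  then show ?thesis
    using has_vector_derivative_integral[OF assms, of x] by (simp add: pi_t_def)
qed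

lemma schwartz_pi_t:
  assumes "f \<in> schwartz_space"
  shows "pi_t f \<in> schwartz_space"
proof (rule schwartz_coinduct)
  show "pi_t f \<in> pi_t ` schwartz_space" using assms by blast
next
  fix h :: "'a rminus \<Rightarrow> complex" assume "h \<in> pi_t ` schwartz_space"
  then obtain f where h: "h = pi_t f" and f: "f \<in> schwartz_space" by blast
  have d: "((\<lambda>s. pi_t f (x + s *\<^sub>R v)) has_vector_derivative
     pi_t (dir_deriv (seq_cons 0 v) f) x) (at 0)" for x v
    by (intro dir_deriv_pi_t schwartz_tame schwartz_dir_deriv f)
  show "tame h"
    unfolding h using f by (intro tameI[OF _ d] continuous_on_pi_t pi_t_decay schwartz_tame)
  fix v
  have "dir_deriv v h = pi_t (dir_deriv (seq_cons 0 v) f)"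
    unfolding h using d by (intro ext dir_derivI)
  then show "dir_deriv v h \<in> pi_t ` schwartz_space"
    using schwartz_dir_deriv[OF f] by blast
qed

lemma pi_t_partial_Suc:
  assumes "f \<in> schwartz_space"
  shows "pi_t (partial u (Suc (Suc i)) f) = partial u (Suc i) (pi_t f)"
proof
  fix x
  have "((\<lambda>s. pi_t f (x + s *\<^sub>R basis_vec u (Suc i))) has_vector_derivative
     pi_t (dir_deriv (seq_cons 0 (basis_vec u (Suc i))) f) x) (at 0)"
    by (intro dir_deriv_pi_t schwartz_tame schwartz_dir_deriv assms)
  then show "pi_t (partial u (Suc (Suc i)) f) x = partial u (Suc i) (pi_t f) x"
    unfolding partial_def by (simp add: dir_derivI seq_cons_basis_vec_Suc)
qed

text \<open>
  The integral does not change when the function is translated in the variable that is integrated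
  out, so its derivative with respect to the translation is zero.
\<close>

lemma pi_t_partial_1:
  assumes f: "f \<in> schwartz_space"
  shows "pi_t (partial u (Suc 0) f) = (\<lambda>x. 0)"
proof
  fix x
  let ?v = "basis_vec u (Suc 0)"
  have "((\<lambda>s. LINT y|lborel. f (seq_cons y x + s *\<^sub>R ?v))
      has_vector_derivative (LINT y|lborel. dir_deriv ?v f (seq_cons y x))) (at 0)"
    by (intro has_vector_derivative_integral schwartz_tame schwartz_dir_deriv f)
  moreover have "(LINT y|lborel. f (seq_cons y x + s *\<^sub>R ?v)) = pi_t f x" for s
  proof -
    have "seq_cons y x + s *\<^sub>R ?v = seq_cons (axis u s + y) x" for y
      using seq_cons_add[of "axis u s" y 0 x] by (simp add: seq_cons_basis_vec_1 add.commute)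
    then have "(LINT y|lborel. f (seq_cons y x + s *\<^sub>R ?v))
        = (LINT y|lborel. f (seq_cons (axis u s + y) x))" by simp
    also have "\<dots> = (LINT y|distr lborel borel ((+) (axis u s)). f (seq_cons y x))"
      using tame_measurable[OF schwartz_tame[OF f]] by (subst integral_distr) auto
    also have "\<dots> = pi_t f x"
      by (simp add: lborel_distr_plus pi_t_def)
    finally show ?thesis .
  qed
  ultimately have "((\<lambda>s::real. pi_t f x) has_vector_derivative pi_t (partial u (Suc 0) f) x) (at 0)"
    by (simp add: partial_def pi_t_def)
  then show "pi_t (partial u (Suc 0) f) x = 0"
    by (intro vector_derivative_unique_at[OF _ has_vector_derivative_const])
qed

lemma pi_t_coord_mult:
  "pi_t (\<lambda>x. of_real (coord v (Suc (Suc i)) x) * f x) = (\<lambda>x. of_real (coord v (Suc i) x) * pi_t f x)"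
  by (simp add: fun_eq_iff pi_t_def coord_seq_cons(2))

lemma pi_t_add:
  assumes "f \<in> schwartz_space" "g \<in> schwartz_space"
  shows "pi_t (\<lambda>x. f x + g x) = (\<lambda>x. pi_t f x + pi_t g x)"
  unfolding pi_t_def using assms
  by (intro ext Bochner_Integration.integral_add tame_integrable schwartz_tame)

lemma pi_t_cmult: "pi_t (\<lambda>x. c * f x) = (\<lambda>x. c * pi_t f x)"
  by (simp add: fun_eq_iff pi_t_def)


section \<open>Symmetry of mixed derivatives\<close>

text \<open>
  On the plane through \<open>x\<close> spanned by \<open>v\<close> and \<open>w\<close>, write \<open>f\<close> as an integral of \<open>\<partial>\<^sub>w f\<close> along \<open>w\<close>,
  differentiate under the integral in direction \<open>v\<close>, and then differentiate with respect to the upper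
  limit at \<open>0\<close>.
\<close>

lemma dir_deriv_commute:
  assumes f: "f \<in> schwartz_space"
  shows "dir_deriv v (dir_deriv w f) = dir_deriv w (dir_deriv v f)"
proof
  fix x
  note tm = schwartz_tame[OF f] schwartz_tame[OF schwartz_dir_deriv[OF f]]
    schwartz_tame[OF schwartz_dir_deriv[OF schwartz_dir_deriv[OF f]]]
  obtain N where N: "{x, v, w} \<subseteq> level N" using finite_ex_level[of "{x, v, w}"] by auto
  have cont: "continuous_on A (\<lambda>p::real \<times> real. g (x + fst p *\<^sub>R v + snd p *\<^sub>R w))" if "tame g" for g A
    by (intro continuous_on_compose2[OF tame_continuous[OF that, of N]] continuous_intros)
       (use N in \<open>auto intro!: level_add level_scale\<close>)
  have cont1: "continuous_on A (\<lambda>t::real. g (x + s *\<^sub>R v + t *\<^sub>R w))" if "tame g" for g A s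
    by (intro continuous_on_compose2[OF tame_continuous[OF that, of N]] continuous_intros)
       (use N in \<open>auto intro!: level_add level_scale\<close>)
  let ?J = "\<lambda>s t. integral {0..t} (\<lambda>r. dir_deriv w f (x + s *\<^sub>R v + r *\<^sub>R w))"
  let ?K = "\<lambda>t. integral {0..t} (\<lambda>r. dir_deriv v (dir_deriv w f) (x + r *\<^sub>R w))"
  have ftc: "f (x + s *\<^sub>R v + t *\<^sub>R w) = f (x + s *\<^sub>R v) + ?J s t" if "t \<ge> 0" for s t
  proof -
    have "((\<lambda>r. dir_deriv w f (x + s *\<^sub>R v + r *\<^sub>R w)) has_integral
        f (x + s *\<^sub>R v + t *\<^sub>R w) - f (x + s *\<^sub>R v + 0 *\<^sub>R w)) {0..t}"
      using that by (intro fundamental_theorem_of_calculus tame_deriv tm)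
    then show ?thesis by (simp add: integral_unique)
  qed
  have leib: "((\<lambda>s. ?J s t) has_vector_derivative ?K t) (at 0)" for t
  proof -
    have "((\<lambda>s. integral (cbox 0 t) (\<lambda>r. dir_deriv w f (x + s *\<^sub>R v + r *\<^sub>R w))) has_vector_derivative
       integral (cbox 0 t) (\<lambda>r. dir_deriv v (dir_deriv w f) (x + 0 *\<^sub>R v + r *\<^sub>R w))) (at 0 within UNIV)"
    proof (rule leibniz_rule_vector_derivative)
      fix s r :: real
      show "((\<lambda>s. dir_deriv w f (x + s *\<^sub>R v + r *\<^sub>R w)) has_vector_derivative
          dir_deriv v (dir_deriv w f) (x + s *\<^sub>R v + r *\<^sub>R w)) (at s within UNIV)"
        using tame_deriv[OF tm(2), where x = "x + r *\<^sub>R w" and v = v and s = s] by (simp add: add_ac)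
      show "(\<lambda>r. dir_deriv w f (x + s *\<^sub>R v + r *\<^sub>R w)) integrable_on cbox 0 t"
        by (intro integrable_continuous cont1 tm)
    next
      show "continuous_on (UNIV \<times> cbox 0 t) (\<lambda>(s, r). dir_deriv v (dir_deriv w f) (x + s *\<^sub>R v + r *\<^sub>R w))"
        using cont[OF tm(3)] by (simp add: case_prod_unfold)
    qed auto
    then show ?thesis by simp
  qed
  have *: "dir_deriv v f (x + t *\<^sub>R w) = dir_deriv v f x + ?K t" if t: "t \<ge> 0" for t
  proof -
    have "((\<lambda>s. f (x + s *\<^sub>R v) + ?J s t) has_vector_derivative dir_deriv v f x + ?K t) (at 0)"
      by (intro has_vector_derivative_add tame_deriv_0 tm leib)
    moreover have "((\<lambda>s. f (x + s *\<^sub>R v + t *\<^sub>R w)) has_vector_derivative dir_deriv v f (x + t *\<^sub>R w)) (at 0)"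
      using tame_deriv_0[OF tm(1), of "x + t *\<^sub>R w" v] by (simp add: add_ac)
    ultimately show ?thesis
      using ftc[OF t] by (intro vector_derivative_unique_at) auto
  qed
  have "(?K has_vector_derivative dir_deriv v (dir_deriv w f) (x + 0 *\<^sub>R w)) (at 0 within {0..1})"
    using cont1[OF tm(3), where s = 0] by (intro integral_has_vector_derivative) auto
  then have "((\<lambda>t. dir_deriv v f x + ?K t) has_vector_derivative dir_deriv v (dir_deriv w f) x) (at 0 within {0..1})"
    using has_vector_derivative_add[OF has_vector_derivative_const] by fastforce
  then have "((\<lambda>t. dir_deriv v f (x + t *\<^sub>R w)) has_vector_derivative dir_deriv v (dir_deriv w f) x) (at 0 within {0..1})"
    by (rule has_vector_derivative_transform[rotated 2]) (simp_all add: *)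
  moreover have "((\<lambda>t. dir_deriv v f (x + t *\<^sub>R w)) has_vector_derivative dir_deriv w (dir_deriv v f) (x + 0 *\<^sub>R w)) (at 0 within {0..1})"
    by (intro tame_deriv tm)
  ultimately show "dir_deriv v (dir_deriv w f) x = dir_deriv w (dir_deriv v f) x"
    using vector_derivative_unique_within_closed_interval[of 0 1 0] by auto
qed

lemma partial_commute:
  "f \<in> schwartz_space \<Longrightarrow> partial u i (partial v j f) = partial v j (partial u i f)"
  unfolding partial_def by (rule dir_deriv_commute)


section \<open>Local linear operators\<close>

text \<open>
  The last clause is a continuity condition for the topology of pointwise agreement on levels: what
  \<open>F f\<close> is on a level depends only on what \<open>f\<close> is on some larger level. It holds for partial
  derivatives and for \<open>pi_t\<close>, both of which look outside the given level.
\<close>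

definition local_linear ::
  "(('n::finite rminus \<Rightarrow> complex) \<Rightarrow> 'n rminus \<Rightarrow> complex) \<Rightarrow> bool" where
  "local_linear F \<longleftrightarrow>
     (\<forall>f\<in>schwartz_space. F f \<in> schwartz_space) \<and>
     (\<forall>f\<in>schwartz_space. \<forall>g\<in>schwartz_space. F (\<lambda>x. f x + g x) = (\<lambda>x. F f x + F g x)) \<and>
     (\<forall>c. \<forall>f\<in>schwartz_space. F (\<lambda>x. c * f x) = (\<lambda>x. c * F f x)) \<and>
     (\<forall>N. \<exists>M. \<forall>f\<in>schwartz_space. (\<forall>x\<in>level M. f x = 0) \<longrightarrow> (\<forall>x\<in>level N. F f x = 0))"

lemma local_linearD:
  assumes "local_linear F"
  shows local_linear_closed: "f \<in> schwartz_space \<Longrightarrow> F f \<in> schwartz_space"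
    and local_linear_add: "f \<in> schwartz_space \<Longrightarrow> g \<in> schwartz_space \<Longrightarrow>
      F (\<lambda>x. f x + g x) = (\<lambda>x. F f x + F g x)"
    and local_linear_cmult: "f \<in> schwartz_space \<Longrightarrow> F (\<lambda>x. c * f x) = (\<lambda>x. c * F f x)"
    and local_linear_local: "\<exists>M. \<forall>f\<in>schwartz_space. (\<forall>x\<in>level M. f x = 0) \<longrightarrow> (\<forall>x\<in>level N. F f x = 0)"
  using assms unfolding local_linear_def by blast+

lemma local_linear_zero: "local_linear F \<Longrightarrow> F (\<lambda>x. 0) = (\<lambda>x. 0)"
  using local_linear_cmult[of F "\<lambda>x. 0" 0] schwartz_zero by simp

lemma local_linear_sum:
  assumes "local_linear F" "\<And>i. i \<in> I \<Longrightarrow> h i \<in> schwartz_space"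
  shows "F (\<lambda>x. \<Sum>i\<in>I. h i x) = (\<lambda>x. \<Sum>i\<in>I. F (h i) x)"
  using assms(2)
proof (induction I rule: infinite_finite_induct)
  case (insert i I)
  then have "F (\<lambda>x. h i x + (\<Sum>i\<in>I. h i x)) = (\<lambda>x. F (h i) x + F (\<lambda>x. \<Sum>i\<in>I. h i x) x)"
    by (intro local_linear_add[OF assms(1)] schwartz_sum) auto
  with insert show ?case by simp
qed (simp_all add: local_linear_zero[OF assms(1)])

lemma local_linear_diff:
  assumes "local_linear F" "f \<in> schwartz_space" "g \<in> schwartz_space"
  shows "F (\<lambda>x. f x - g x) = (\<lambda>x. F f x - F g x)"
  using local_linear_add[OF assms(1,2) schwartz_cmult[OF assms(3), of "-1"]]
    local_linear_cmult[OF assms(1,3), of "-1"] by simp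

lemma local_linear_id: "local_linear (\<lambda>f. f)"
  unfolding local_linear_def by blast

lemma local_linear_compose:
  fixes F G :: "('n::finite rminus \<Rightarrow> complex) \<Rightarrow> 'n rminus \<Rightarrow> complex"
  assumes F: "local_linear F" and G: "local_linear G"
  shows "local_linear (\<lambda>f. F (G f))"
  unfolding local_linear_def
proof (intro conjI ballI allI)
  fix N
  obtain M where M: "\<forall>f\<in>schwartz_space. (\<forall>x\<in>level M. f x = 0) \<longrightarrow> (\<forall>x\<in>level N. F f x = 0)"
    using local_linear_local[OF F] by blast
  obtain K where K: "\<forall>f\<in>schwartz_space. (\<forall>x\<in>level K. f x = 0) \<longrightarrow> (\<forall>x\<in>level M. G f x = 0)"
    using local_linear_local[OF G] by blast
  show "\<exists>M. \<forall>f\<in>schwartz_space. (\<forall>x\<in>level M. f x = 0) \<longrightarrow> (\<forall>x\<in>level N. F (G f) x = 0)"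
  proof (intro exI[of _ K] ballI impI)
    fix f :: "'n rminus \<Rightarrow> complex" and x :: "'n rminus"
    assume "f \<in> schwartz_space" "\<forall>x\<in>level K. f x = 0" "x \<in> level N"
    then show "F (G f) x = 0"
      using M[rule_format, OF local_linear_closed[OF G]] K by simp
  qed
qed (simp_all add: local_linear_closed[OF F] local_linear_add[OF F] local_linear_cmult[OF F]
    local_linear_closed[OF G] local_linear_add[OF G] local_linear_cmult[OF G])

lemma local_linear_funpow: "local_linear F \<Longrightarrow> local_linear (F ^^ j)"
proof (induction j)
  case 0
  then show ?case using local_linear_id by (simp add: id_def)
next
  case (Suc j)
  then show ?case using local_linear_compose[of F "F ^^ j"] by (simp add: o_def)
qed

definition locally_finite :: "('i \<Rightarrow> 'n::finite rminus \<Rightarrow> complex) \<Rightarrow> bool" where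
  "locally_finite h \<longleftrightarrow> (\<forall>N. \<exists>A. finite A \<and> (\<forall>a. a \<notin> A \<longrightarrow> (\<forall>x\<in>level N. h a x = 0)))"

lemma locally_finiteE:
  assumes "locally_finite h"
  obtains A where "finite A" "\<And>a x. a \<notin> A \<Longrightarrow> x \<in> level N \<Longrightarrow> h a x = 0"
  using assms unfolding locally_finite_def by meson

lemma locally_finite_support:
  assumes "locally_finite h"
  shows "finite {a. h a x \<noteq> 0}"
proof -
  obtain N where N: "x \<in> level N" using ex_level by blast
  obtain A where "finite A" "\<And>a x. a \<notin> A \<Longrightarrow> x \<in> level N \<Longrightarrow> h a x = 0"
    using locally_finiteE[OF assms] by metis
  then show ?thesis using N by (auto intro: finite_subset[of _ A])
qed

lemma Sum_any_level:
  assumes "finite A" "\<And>a x. a \<notin> A \<Longrightarrow> x \<in> level N \<Longrightarrow> h a x = 0" "x \<in> level N"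
  shows "Sum_any (\<lambda>a. h a x) = (\<Sum>a\<in>A. h a x)"
  using assms by (intro Sum_any.expand_superset) auto

lemma schwartz_Sum_any:
  assumes "locally_finite h" "\<And>a. h a \<in> schwartz_space"
  shows "(\<lambda>x. Sum_any (\<lambda>a. h a x)) \<in> schwartz_space"
proof (rule schwartz_local)
  fix N
  obtain A where A: "finite A" "\<And>a x. a \<notin> A \<Longrightarrow> x \<in> level N \<Longrightarrow> h a x = 0"
    using locally_finiteE[OF assms(1)] by metis
  show "\<exists>g\<in>schwartz_space. \<forall>x\<in>level N. (Sum_any (\<lambda>a. h a x)) = g x"
    by (intro bexI[of _ "\<lambda>x. \<Sum>a\<in>A. h a x"] ballI schwartz_sum assms(2)
        Sum_any_level[where h = h and N = N, OF A])
qed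

text \<open>
  On a fixed level the sum can be truncated both before and after applying \<open>F\<close>, by locality; for
  finite sums the claim is linearity.
\<close>

lemma local_linear_Sum_any:
  fixes F :: "('n::finite rminus \<Rightarrow> complex) \<Rightarrow> 'n rminus \<Rightarrow> complex"
  assumes F: "local_linear F" and h: "locally_finite h" "\<And>a. h a \<in> schwartz_space"
  shows "locally_finite (\<lambda>a. F (h a))"
    and "F (\<lambda>x. Sum_any (\<lambda>a. h a x)) = (\<lambda>x. Sum_any (\<lambda>a. F (h a) x))"
proof -
  have *: "\<exists>A. finite A \<and> (\<forall>a. a \<notin> A \<longrightarrow> (\<forall>x\<in>level N. F (h a) x = 0)) \<and>
      (\<forall>x\<in>level N. F (\<lambda>x. Sum_any (\<lambda>a. h a x)) x = (\<Sum>a\<in>A. F (h a) x))" for N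
  proof -
    obtain M where M: "\<forall>f\<in>schwartz_space. (\<forall>x\<in>level M. f x = 0) \<longrightarrow> (\<forall>x\<in>level N. F f x = 0)"
      using local_linear_local[OF F] by blast
    obtain A where A: "finite A" "\<And>a x. a \<notin> A \<Longrightarrow> x \<in> level M \<Longrightarrow> h a x = 0"
      using locally_finiteE[OF h(1)] by metis
    have S: "(\<lambda>x. Sum_any (\<lambda>a. h a x)) \<in> schwartz_space" "(\<lambda>x. \<Sum>a\<in>A. h a x) \<in> schwartz_space"
      using h by (auto intro: schwartz_Sum_any schwartz_sum)
    have "(\<lambda>x. (Sum_any (\<lambda>a. h a x)) - (\<Sum>a\<in>A. h a x)) \<in> schwartz_space"
      using schwartz_add[OF S(1) schwartz_cmult[OF S(2), of "-1"]] by simp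
    from M[rule_format, OF this]
    have "\<forall>x\<in>level N. F (\<lambda>x. (Sum_any (\<lambda>a. h a x)) - (\<Sum>a\<in>A. h a x)) x = 0"
      using Sum_any_level[where h = h and N = M, OF A] by simp
    then have "\<forall>x\<in>level N. F (\<lambda>x. Sum_any (\<lambda>a. h a x)) x = (\<Sum>a\<in>A. F (h a) x)"
      by (simp add: local_linear_diff[OF F S] local_linear_sum[OF F h(2)])
    moreover have "\<forall>a. a \<notin> A \<longrightarrow> (\<forall>x\<in>level N. F (h a) x = 0)"
      using M[rule_format, OF h(2)] A(2) by simp
    ultimately show ?thesis using A(1) by (intro exI[of _ A] conjI)
  qed
  then show "locally_finite (\<lambda>a. F (h a))"
    unfolding locally_finite_def by meson
  show "F (\<lambda>x. Sum_any (\<lambda>a. h a x)) = (\<lambda>x. Sum_any (\<lambda>a. F (h a) x))"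
  proof
    fix x :: "'n rminus"
    obtain N where N: "x \<in> level N" using ex_level by blast
    obtain A where "finite A" "\<forall>a. a \<notin> A \<longrightarrow> (\<forall>x\<in>level N. F (h a) x = 0)"
      "\<forall>x\<in>level N. F (\<lambda>x. Sum_any (\<lambda>a. h a x)) x = (\<Sum>a\<in>A. F (h a) x)"
      using *[of N] by blast
    with N show "F (\<lambda>x. Sum_any (\<lambda>a. h a x)) x = Sum_any (\<lambda>a. F (h a) x)"
      by (subst Sum_any.expand_superset[of A]) auto
  qed
qed

lemma local_linear_Sum_any_op:
  fixes F :: "'i \<Rightarrow> ('b::finite rminus \<Rightarrow> complex) \<Rightarrow> 'b rminus \<Rightarrow> complex"
  assumes F: "\<And>a. local_linear (F a)"
    and fin: "\<And>N. \<exists>A. finite A \<and> (\<forall>a f (x :: 'b rminus). a \<notin> A \<longrightarrow> x \<in> level N \<longrightarrow> F a f x = 0)"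
  shows "local_linear (\<lambda>f x. Sum_any (\<lambda>a. F a f x))"
proof -
  have lf: "locally_finite (\<lambda>a. F a f)" for f
    unfolding locally_finite_def using fin by meson
  note fs = locally_finite_support[OF lf]
  show ?thesis
    unfolding local_linear_def
  proof (intro conjI ballI allI)
    fix f g :: "'b rminus \<Rightarrow> complex"
    assume f: "f \<in> schwartz_space" and g: "g \<in> schwartz_space"
    show "(\<lambda>x. Sum_any (\<lambda>a. F a (\<lambda>x. f x + g x) x)) = (\<lambda>x. (Sum_any (\<lambda>a. F a f x)) + (Sum_any (\<lambda>a. F a g x)))"
      using fs by (simp add: local_linear_add[OF F f g] Sum_any.distrib)
  next
    fix f :: "'b rminus \<Rightarrow> complex" and c assume f: "f \<in> schwartz_space"
    show "(\<lambda>x. Sum_any (\<lambda>a. F a (\<lambda>x. c * f x) x)) = (\<lambda>x. c * (Sum_any (\<lambda>a. F a f x)))"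
      using fs by (simp add: local_linear_cmult[OF F f] Sum_any_right_distrib)
    show "(\<lambda>x. Sum_any (\<lambda>a. F a f x)) \<in> schwartz_space"
      by (intro schwartz_Sum_any lf local_linear_closed[OF F f])
  next
    fix N
    obtain A where A: "finite A" "\<forall>a (f :: 'b rminus \<Rightarrow> complex) x. a \<notin> A \<longrightarrow> x \<in> level N \<longrightarrow> F a f x = 0"
      using fin by blast
    have "\<forall>a. \<exists>M. \<forall>f\<in>schwartz_space. (\<forall>x\<in>level M. f x = 0) \<longrightarrow> (\<forall>x\<in>level N. F a f x = 0)"
      using local_linear_local[OF F] by blast
    then obtain M where M: "\<And>a f x. f\<in>schwartz_space \<Longrightarrow> (\<forall>x\<in>level (M a). f x = 0) \<Longrightarrow> x\<in>level N \<Longrightarrow> F a f x = 0"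
      by metis
    obtain K where K: "\<And>a. a \<in> A \<Longrightarrow> M a \<le> K"
      using A(1) by (metis Max_ge finite_imageI imageI)
    show "\<exists>M. \<forall>f\<in>schwartz_space. (\<forall>x\<in>level M. f x = 0) \<longrightarrow> (\<forall>x\<in>level N. (Sum_any (\<lambda>a. F a f x)) = 0)"
    proof (intro exI[of _ K] ballI impI)
      fix f :: "'b rminus \<Rightarrow> complex" and x :: "'b rminus"
      assume f: "f \<in> schwartz_space" "\<forall>x\<in>level K. f x = 0" and x: "x \<in> level N"
      have "F a f x = 0" for a
      proof (cases "a \<in> A")
        case True
        then show ?thesis using f x K[OF True] by (intro M) (auto intro: mem_level_mono)
      qed (use A x in auto)
      then show "(Sum_any (\<lambda>a. F a f x)) = 0" by simp
    qed
  qed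
qed

lemma local_linear_scale:
  assumes F: "local_linear F"
  shows "local_linear (\<lambda>f x. c * F f x)"
  unfolding local_linear_def
proof (intro conjI ballI allI)
  fix N
  obtain M where "\<forall>f\<in>schwartz_space. (\<forall>x\<in>level M. f x = 0) \<longrightarrow> (\<forall>x\<in>level N. F f x = 0)"
    using local_linear_local[OF F] by blast
  then show "\<exists>M. \<forall>f\<in>schwartz_space. (\<forall>x\<in>level M. f x = 0) \<longrightarrow> (\<forall>x\<in>level N. c * F f x = 0)"
    by (intro exI[of _ M]) auto
qed (simp_all add: local_linear_closed[OF F] local_linear_add[OF F] local_linear_cmult[OF F]
    schwartz_cmult distrib_left mult.left_commute)

lemma local_linear_lincomb:
  assumes F: "\<And>a. local_linear (F a)"
  shows "local_linear (\<lambda>f x. \<Sum>a\<in>(UNIV :: 'i::finite set). c a * F a f x)"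
proof -
  have "local_linear (\<lambda>f x. Sum_any (\<lambda>a. c a * F a f x))"
    by (rule local_linear_Sum_any_op) (use F in \<open>auto intro: local_linear_scale exI[of _ UNIV]\<close>)
  then show ?thesis
    by (simp add: Sum_any.expand_superset[of UNIV])
qed

lemma local_linear_pi_t: "local_linear (pi_t :: ('n::finite rminus \<Rightarrow> complex) \<Rightarrow> _)"
  unfolding local_linear_def
proof (intro conjI ballI allI)
  fix N
  show "\<exists>M. \<forall>f\<in>schwartz_space. (\<forall>x\<in>level M. f x = 0) \<longrightarrow> (\<forall>x\<in>level N. pi_t f (x :: 'n rminus) = 0)"
    by (intro exI[of _ "Suc N"]) (auto simp: pi_t_def seq_cons_level)
qed (simp_all add: schwartz_pi_t pi_t_add pi_t_cmult)


section \<open>Coordinates and derivatives indexed by the integers\<close>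

text \<open>
  Multiplication by \<open>x\<^sup>v\<^sub>-\<^sub>c\<close> and differentiation by \<open>x\<^sup>u\<^sub>-\<^sub>a\<close>, set to zero for indices below \<open>1\<close>. With
  this convention the vector fields are sums over all integers, which can be reindexed freely, and
  shifting a derivative past \<open>pi_t\<close> needs no case distinction.
\<close>

definition coord_op :: "'n::finite \<Rightarrow> int \<Rightarrow> ('n rminus \<Rightarrow> complex) \<Rightarrow> 'n rminus \<Rightarrow> complex" where
  "coord_op v c f = (\<lambda>x. if c \<ge> 1 then of_real (coord v (nat c) x) * f x else 0)"

definition deriv_op :: "'n::finite \<Rightarrow> int \<Rightarrow> ('n rminus \<Rightarrow> complex) \<Rightarrow> 'n rminus \<Rightarrow> complex" where
  "deriv_op u a f = (\<lambda>x. if a \<ge> 1 then partial u (nat a) f x else 0)"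

lemma pos_intE:
  assumes "(a::int) \<ge> 1"
  obtains i where "a = int (Suc i)"
  using assms that[of "nat (a - 1)"] by simp

lemma local_linear_coord_op: "local_linear (coord_op v c)"
  unfolding local_linear_def
proof (intro conjI ballI allI)
  fix f :: "'a rminus \<Rightarrow> complex" assume "f \<in> schwartz_space"
  then show "coord_op v c f \<in> schwartz_space"
    by (cases "c \<ge> 1") (auto simp: coord_op_def intro: schwartz_coord_mult schwartz_zero)
next
  fix N
  show "\<exists>M. \<forall>f\<in>schwartz_space. (\<forall>x\<in>level M. f x = 0) \<longrightarrow> (\<forall>x\<in>level N. coord_op v c f x = 0)"
    by (auto simp: coord_op_def)
qed (auto simp: coord_op_def fun_eq_iff algebra_simps)

lemma local_linear_deriv_op: "local_linear (deriv_op u a)"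
proof (cases "a \<ge> 1")
  case True
  then obtain i where i: "a = int (Suc i)" by (rule pos_intE)
  have *: "deriv_op u a = dir_deriv (basis_vec u (Suc i))"
    by (simp add: deriv_op_def partial_def i fun_eq_iff nat_add_distrib)
  show ?thesis
    unfolding local_linear_def *
  proof (intro conjI ballI allI)
    fix N
    have "dir_deriv (basis_vec u (Suc i)) f x = 0"
      if "\<forall>x\<in>level (max N (Suc i)). f x = 0" "x \<in> level N" for f x
    proof -
      have "dir_deriv (basis_vec u (Suc i)) f x = dir_deriv (basis_vec u (Suc i)) (\<lambda>x. 0) x"
        by (rule dir_deriv_level_cong[of "max N (Suc i)"])
           (use that mem_level_mono[OF that(2)] mem_level_mono[OF basis_vec_level[of u i]] in auto)
      also have "\<dots> = 0" by (rule dir_derivI) simp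
      finally show ?thesis .
    qed
    then show "\<exists>M. \<forall>f\<in>schwartz_space. (\<forall>x\<in>level M. f x = 0) \<longrightarrow>
        (\<forall>x\<in>level N. dir_deriv (basis_vec u (Suc i)) f x = 0)"
      by (intro exI[of _ "max N (Suc i)"]) simp
  qed (simp_all add: schwartz_dir_deriv tame_add tame_cmult schwartz_tame)
next
  case False
  then show ?thesis
    by (simp add: deriv_op_def local_linear_def schwartz_zero)
qed

lemmas schwartz_coord_op = local_linear_closed[OF local_linear_coord_op]
lemmas schwartz_deriv_op = local_linear_closed[OF local_linear_deriv_op]

lemma coord_op_add: "coord_op v c (\<lambda>x. f x + g x) = (\<lambda>x. coord_op v c f x + coord_op v c g x)"
  by (auto simp: coord_op_def fun_eq_iff algebra_simps)

lemma coord_op_commute: "coord_op v c (coord_op w d f) = coord_op w d (coord_op v c f)"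
  by (auto simp: coord_op_def fun_eq_iff)

lemma coord_op_zero: "coord_op v c (\<lambda>x. 0) = (\<lambda>x. 0)"
  by (simp add: coord_op_def fun_eq_iff)

lemma deriv_op_nonpos: "a \<le> 0 \<Longrightarrow> deriv_op u a f = (\<lambda>x. 0)"
  by (simp add: deriv_op_def fun_eq_iff)

lemma deriv_op_commute:
  assumes "f \<in> schwartz_space"
  shows "deriv_op u a (deriv_op v b f) = deriv_op v b (deriv_op u a f)"
proof (cases "a \<ge> 1 \<and> b \<ge> 1")
  case True
  then have "deriv_op u a g = partial u (nat a) g" "deriv_op v b g = partial v (nat b) g" for g
    by (simp_all add: deriv_op_def fun_eq_iff)
  then show ?thesis using partial_commute[OF assms] by simp
next
  case False
  then show ?thesis
    using local_linear_zero[OF local_linear_deriv_op, of u a]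
      local_linear_zero[OF local_linear_deriv_op, of v b]
    by (auto simp: deriv_op_nonpos)
qed

lemma deriv_op_coord_op:
  assumes f: "f \<in> schwartz_space"
  shows "deriv_op u a (coord_op v c f) = (\<lambda>x. coord_op v c (deriv_op u a f) x
    + (if u = v \<and> a = c \<and> a \<ge> 1 then f x else 0))"
proof (cases "a \<ge> 1 \<and> c \<ge> 1")
  case True
  then obtain i j where ij: "a = int (Suc i)" "c = int (Suc j)"
    using pos_intE by metis
  show ?thesis
    unfolding deriv_op_def coord_op_def partial_def
    by (auto simp: ij nat_add_distrib tame_coord_mult(2)[OF schwartz_tame[OF f]] coord_basis_vec fun_eq_iff)
next
  case False
  then show ?thesis
    using local_linear_zero[OF local_linear_deriv_op, of u a]
    by (auto simp: deriv_op_nonpos coord_op_def)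
qed

text \<open>
  The exception \<open>c = 1\<close> is multiplication by the integration variable itself. It is the source of all
  correction terms below.
\<close>

lemma pi_t_coord_op:
  assumes "c \<noteq> 1"
  shows "pi_t (coord_op v c f) = coord_op v (c - 1) (pi_t f)"
proof (cases "c \<ge> 2")
  case True
  then have "c = int (nat (c - 2)) + 2" by simp
  then obtain i where i: "c = int i + 2" ..
  then have "nat c = Suc (Suc i)" "nat (c - 1) = Suc i" by auto
  then show ?thesis
    unfolding coord_op_def using True by (simp add: pi_t_coord_mult)
next
  case False
  with assms show ?thesis by (simp add: coord_op_def pi_t_def fun_eq_iff)
qed

text \<open>
  For \<open>a = 1\<close> both sides vanish: the left one as the integral of a derivative, the right one by the
  convention for nonpositive indices.
\<close>

lemma pi_t_deriv_op:
  assumes f: "f \<in> schwartz_space"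
  shows "pi_t (deriv_op u a f) = deriv_op u (a - 1) (pi_t f)"
proof -
  consider "a \<le> 0" | "a = 1" | i where "a = int i + 2"
  proof -
    have "a \<le> 0 \<or> a = 1 \<or> a = int (nat (a - 2)) + 2" by auto
    with that show thesis by blast
  qed
  then show ?thesis
  proof cases
    case 1
    then show ?thesis by (simp add: deriv_op_nonpos pi_t_def fun_eq_iff)
  next
    case 2
    then show ?thesis by (simp add: deriv_op_def pi_t_partial_1[OF f])
  next
    case (3 i)
    then have "nat a = Suc (Suc i)" "nat (a - 1) = Suc i" by auto
    with 3 show ?thesis by (simp add: deriv_op_def pi_t_partial_Suc[OF f])
  qed
qed

lemma pi_t_pow_deriv_op:
  assumes "f \<in> schwartz_space"
  shows "(pi_t ^^ j) (deriv_op u a f) = deriv_op u (a - int j) ((pi_t ^^ j) f)"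
proof (induction j)
  case (Suc j)
  then show ?case
    using pi_t_deriv_op[OF local_linear_closed[OF local_linear_funpow[OF local_linear_pi_t] assms], of u "a - int j" j]
    by (simp add: algebra_simps)
qed simp


section \<open>Vector fields of the loop algebra\<close>

text \<open>
  The field \<open>loop_field u v k\<close> is \<open>\<Sum>\<^sub>a x\<^sup>v\<^sub>-\<^sub>a\<^sub>-\<^sub>k \<partial>\<^sub>x\<^sup>u\<^sub>-\<^sub>a\<close>; the variant with a lower bound \<open>m\<close> for
  \<open>a\<close> appears in commutators.
\<close>

definition loop_field_from :: "int \<Rightarrow> 'n::finite \<Rightarrow> 'n \<Rightarrow> int \<Rightarrow> ('n rminus \<Rightarrow> complex) \<Rightarrow> 'n rminus \<Rightarrow> complex" where
  "loop_field_from m u v k f = (\<lambda>x. Sum_any (\<lambda>a. if a \<ge> m then coord_op v (a + k) (deriv_op u a f) x else 0))"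

definition loop_field :: "'n::finite \<Rightarrow> 'n \<Rightarrow> int \<Rightarrow> ('n rminus \<Rightarrow> complex) \<Rightarrow> 'n rminus \<Rightarrow> complex" where
  "loop_field u v k f = (\<lambda>x. Sum_any (\<lambda>a. coord_op v (a + k) (deriv_op u a f) x))"

lemma coord_op_deriv_op_support:
  assumes "x \<in> level N" "a \<notin> {1..int N - k}"
  shows "coord_op v (a + k) (deriv_op u a f) x = 0"
  using assms by (auto simp: coord_op_def deriv_op_def coord_level)

lemma coord_op_local_linear_deriv_op_support:
  assumes "local_linear F" "x \<in> level N" "a \<notin> {1..int N - k}"
  shows "coord_op v (a + k) (F (deriv_op u a f)) x = 0"
proof (cases "a \<ge> 1")
  case False
  then show ?thesis by (simp add: deriv_op_nonpos local_linear_zero[OF assms(1)] coord_op_zero)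
qed (use assms in \<open>auto simp: coord_op_def coord_level\<close>)

text \<open>
  The operator \<open>F\<close> leaves room for another vector field between the coordinate and the derivative,
  as in a product of two fields.
\<close>

lemma locally_finite_coord_op_deriv_op:
  assumes "local_linear F"
  shows "locally_finite (\<lambda>a. coord_op v (a + k) (F (deriv_op u a f)))"
  unfolding locally_finite_def
proof (intro allI exI[of _ "{1..int N - k}" for N] conjI impI ballI)
  fix N a x assume "a \<notin> {1..int N - k}" "x \<in> (level N :: 'a rminus set)"
  then show "coord_op v (a + k) (F (deriv_op u a f)) x = 0"
    by (intro coord_op_local_linear_deriv_op_support[OF assms])
qed simp

lemmas loop_field_locally_finite = locally_finite_coord_op_deriv_op[OF local_linear_id]
lemmas loop_field_finite_support = locally_finite_support[OF loop_field_locally_finite]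

lemma local_linear_loop_field: "local_linear (loop_field u v k)"
proof -
  have "local_linear (\<lambda>f x. Sum_any (\<lambda>a. coord_op v (a + k) (deriv_op u a f) x))"
  proof (rule local_linear_Sum_any_op)
    show "local_linear (\<lambda>f. coord_op v (a + k) (deriv_op u a f))" for a
      by (rule local_linear_compose[OF local_linear_coord_op local_linear_deriv_op])
    show "\<exists>A. finite A \<and> (\<forall>a f x. a \<notin> A \<longrightarrow> x \<in> level N \<longrightarrow> coord_op v (a + k) (deriv_op u a f) x = 0)" for N
      by (intro exI[of _ "{1..int N - k}"]) (auto intro!: coord_op_deriv_op_support)
  qed
  then show ?thesis by (simp add: loop_field_def[abs_def])
qed

lemma schwartz_loop_field: "f \<in> schwartz_space \<Longrightarrow> loop_field u v k f \<in> schwartz_space"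
  by (rule local_linear_closed[OF local_linear_loop_field])

lemma loop_field_eq_loop_field_from:
  assumes "m \<ge> 1"
  shows "loop_field u v k f x = loop_field_from m u v k f x
    + (\<Sum>a\<in>{1..<m}. coord_op v (a + k) (deriv_op u a f) x)"
proof -
  let ?h = "\<lambda>a. coord_op v (a + k) (deriv_op u a f) x"
  have *: "(\<Sum>a\<in>{1..<m}. ?h a) = Sum_any (\<lambda>a. if a \<ge> m then 0 else ?h a)"
    by (subst Sum_any.expand_superset[of "{1..<m}"])
       (auto simp: deriv_op_nonpos coord_op_zero intro: sum.cong intro!: linorder_not_less[THEN iffD1])
  have "Sum_any ?h = Sum_any (\<lambda>a. (if a \<ge> m then ?h a else 0) + (if a \<ge> m then 0 else ?h a))"
    by (rule Sum_any.cong) simp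
  also have "\<dots> = Sum_any (\<lambda>a. if a \<ge> m then ?h a else 0) + Sum_any (\<lambda>a. if a \<ge> m then 0 else ?h a)"
    by (intro Sum_any.distrib finite_subset[OF _ loop_field_finite_support[of v k u f x]]) auto
  finally show ?thesis by (simp add: loop_field_def loop_field_from_def *)
qed

lemma loop_field_from_le_1: "m \<le> 1 \<Longrightarrow> loop_field_from m u v k f = loop_field u v k f"
  unfolding loop_field_def loop_field_from_def
  by (intro ext Sum_any.cong) (auto simp: deriv_op_nonpos coord_op_zero)

text \<open>
  The product rule for the field applied to a product with a coordinate: the field maps \<open>x\<^sup>u\<^sub>-\<^sub>c\<close> to
  \<open>x\<^sup>v\<^sub>-\<^sub>c\<^sub>-\<^sub>k\<close> and all other coordinates to zero.
\<close>

lemma loop_field_coord_op: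
  assumes f: "f \<in> schwartz_space"
  shows "loop_field u v k (coord_op w c f) x = coord_op w c (loop_field u v k f) x
    + (if u = w \<and> c \<ge> 1 then coord_op v (c + k) f x else 0)"
proof -
  have "coord_op v (a + k) (deriv_op u a (coord_op w c f)) x
     = coord_op w c (coord_op v (a + k) (deriv_op u a f)) x
       + (if a = c then if u = w \<and> c \<ge> 1 then coord_op v (c + k) f x else 0 else 0)" for a
    unfolding deriv_op_coord_op[OF f] coord_op_add coord_op_commute[of w c]
    by (auto simp: coord_op_def)
  then have "loop_field u v k (coord_op w c f) x = Sum_any (\<lambda>a. coord_op w c (coord_op v (a + k) (deriv_op u a f)) x
       + (if a = c then if u = w \<and> c \<ge> 1 then coord_op v (c + k) f x else 0 else 0))"
    by (simp only: loop_field_def)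
  also have "\<dots> = Sum_any (\<lambda>a. coord_op w c (coord_op v (a + k) (deriv_op u a f)) x)
       + (if u = w \<and> c \<ge> 1 then coord_op v (c + k) f x else 0)"
    by (subst Sum_any.distrib)
       (auto intro!: finite_subset[OF _ loop_field_finite_support[of v k u f x]] simp: coord_op_def)
  also have "Sum_any (\<lambda>a. coord_op w c (coord_op v (a + k) (deriv_op u a f)) x) = coord_op w c (loop_field u v k f) x"
    unfolding loop_field_def
    by (subst local_linear_Sum_any(2)[OF local_linear_coord_op loop_field_locally_finite])
       (simp_all add: f schwartz_coord_op schwartz_deriv_op)
  finally show ?thesis .
qed

text \<open>
  Among the coefficients of the field only that of \<open>\<partial>\<^sub>x\<^sup>u\<^sub>-\<^sub>b\<close> with \<open>b = a - k\<close> depends on \<open>x\<^sup>v\<^sub>-\<^sub>a\<close>. If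
  this \<open>b\<close> is not positive, there is no such term, in agreement with the convention for \<open>deriv_op\<close>.
\<close>

lemma deriv_op_loop_field:
  assumes f: "f \<in> schwartz_space"
  shows "deriv_op w a (loop_field u v k f) x = loop_field u v k (deriv_op w a f) x
    + (if w = v \<and> a \<ge> 1 then deriv_op u (a - k) f x else 0)"
proof -
  have "deriv_op w a (loop_field u v k f) x
      = Sum_any (\<lambda>b. deriv_op w a (coord_op v (b + k) (deriv_op u b f)) x)"
    unfolding loop_field_def
    by (subst local_linear_Sum_any(2)[OF local_linear_deriv_op loop_field_locally_finite])
       (simp_all add: f schwartz_coord_op schwartz_deriv_op)
  also have "\<dots> = Sum_any (\<lambda>b. coord_op v (b + k) (deriv_op u b (deriv_op w a f)) x
       + (if b = a - k then if w = v \<and> a \<ge> 1 then deriv_op u (a - k) f x else 0 else 0))"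
    unfolding deriv_op_coord_op[OF schwartz_deriv_op[OF f]] deriv_op_commute[OF f, of w]
    by (intro Sum_any.cong) auto
  also have "\<dots> = loop_field u v k (deriv_op w a f) x
       + (if w = v \<and> a \<ge> 1 then deriv_op u (a - k) f x else 0)"
    unfolding loop_field_def
    by (subst Sum_any.distrib)
       (auto intro!: finite_subset[OF _ loop_field_finite_support[of v k u _ x]])
  finally show ?thesis .
qed

lemma finite_shift: "finite {b. P b} \<Longrightarrow> finite {a. P (a - l)}" for l :: int
  using finite_vimageI[of "{b. P b}" "\<lambda>a. a - l"] by (simp add: vimage_def inj_def)

text \<open>
  The commutator of two fields. In each product the second-order terms are
  \<open>\<Sum>\<^sub>a x\<^sup>v\<^sub>-\<^sub>a\<^sub>-\<^sub>k R \<partial>\<^sub>x\<^sup>u\<^sub>-\<^sub>a\<close> with \<open>R\<close> the other field, and they agree. The first-order terms are fields of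
  degree \<open>k + l\<close>, but they contain only those terms in which the intermediate variable has a positive
  index; this is where the lower bounds \<open>1 - k\<close> and \<open>1 - l\<close> come from.
\<close>

lemma loop_field_loop_field:
  assumes f: "f \<in> schwartz_space"
  shows "loop_field u v k (loop_field u' v' l f) x + (if u' = v then loop_field_from (1 - k) u v' (k + l) f x else 0)
    = loop_field u' v' l (loop_field u v k f) x + (if u = v' then loop_field_from (1 - l) u' v (k + l) f x else 0)"
proof -
  let ?c = "\<lambda>a. coord_op v (a + k) (loop_field u' v' l (deriv_op u a f)) x"
  have fin: "finite {a. ?c a \<noteq> 0}"
    by (intro locally_finite_support locally_finite_coord_op_deriv_op local_linear_loop_field)
  have "coord_op v (a + k) (deriv_op u a (loop_field u' v' l f)) x = ?c a
     + (if u = v' \<and> a \<ge> 1 then coord_op v (a + k) (deriv_op u' (a - l) f) x else 0)" for a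
    by (simp add: coord_op_def deriv_op_loop_field[OF f] distrib_left)
  then have "loop_field u v k (loop_field u' v' l f) x = Sum_any (\<lambda>a. ?c a
     + (if u = v' \<and> a \<ge> 1 then coord_op v (a + k) (deriv_op u' (a - l) f) x else 0))"
    by (simp only: loop_field_def[of u v])
  also have "\<dots> = Sum_any ?c
     + Sum_any (\<lambda>a. if u = v' \<and> a \<ge> 1 then coord_op v (a + k) (deriv_op u' (a - l) f) x else 0)"
  proof (intro Sum_any.distrib fin)
    have "finite {a. coord_op v (a - l + (k + l)) (deriv_op u' (a - l) f) x \<noteq> 0}"
      by (rule finite_shift) (rule loop_field_finite_support)
    then show "finite {a. (if u = v' \<and> a \<ge> 1 then coord_op v (a + k) (deriv_op u' (a - l) f) x else 0) \<noteq> 0}"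
      by (rule rev_finite_subset) (auto simp: algebra_simps)
  qed
  also have "Sum_any (\<lambda>a. if u = v' \<and> a \<ge> 1 then coord_op v (a + k) (deriv_op u' (a - l) f) x else 0)
     = Sum_any (\<lambda>b. if u = v' \<and> b \<ge> 1 - l then coord_op v (b + (k + l)) (deriv_op u' b f) x else 0)"
    by (rule Sum_any.reindex_cong[of "\<lambda>b. b + l"])
       (auto simp: fun_eq_iff algebra_simps intro!: o_bij[of "\<lambda>b. b - l"])
  finally have 1: "loop_field u v k (loop_field u' v' l f) x
     = Sum_any ?c + (if u = v' then loop_field_from (1 - l) u' v (k + l) f x else 0)"
    by (cases "u = v'") (simp_all add: loop_field_from_def)
  have "loop_field u' v' l (loop_field u v k f) x
      = Sum_any (\<lambda>a. loop_field u' v' l (coord_op v (a + k) (deriv_op u a f)) x)"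
    unfolding loop_field_def[of u v]
    by (subst local_linear_Sum_any(2)[OF local_linear_loop_field loop_field_locally_finite])
       (simp_all add: f schwartz_coord_op schwartz_deriv_op)
  also have "\<dots> = Sum_any (\<lambda>a. ?c a
      + (if u' = v \<and> a \<ge> 1 - k then coord_op v' (a + (k + l)) (deriv_op u a f) x else 0))"
    by (intro Sum_any.cong) (auto simp: loop_field_coord_op[OF schwartz_deriv_op[OF f]] algebra_simps)
  also have "\<dots> = Sum_any ?c
      + Sum_any (\<lambda>a. if u' = v \<and> a \<ge> 1 - k then coord_op v' (a + (k + l)) (deriv_op u a f) x else 0)"
    by (intro Sum_any.distrib fin finite_subset[OF _ loop_field_finite_support[of v' "k + l" u f x]]) auto
  finally have 2: "loop_field u' v' l (loop_field u v k f) x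
      = Sum_any ?c + (if u' = v then loop_field_from (1 - k) u v' (k + l) f x else 0)"
    by (cases "u' = v") (simp_all add: loop_field_from_def)
  show ?thesis using 1 2 by simp
qed


section \<open>Integrating the vector fields\<close>

lemma local_linear_pi_t_pow: "local_linear (pi_t ^^ j)"
  by (rule local_linear_funpow[OF local_linear_pi_t])

text \<open>
  Termwise, \<open>pi_t\<close> lowers both indices by one. The only exceptional term is \<open>x\<^sup>v\<^sub>-\<^sub>1 \<partial>\<^sub>x\<^sup>u\<^sub>-\<^sub>a\<close> with
  \<open>a = 1 - k\<close>, whose coefficient is the integration variable. There the derivative is moved to the left
  before integrating; the scalar is the commutator that this costs.
\<close>

lemma pi_t_loop_field:
  assumes f: "f \<in> schwartz_space"
  shows "pi_t (loop_field u v k f) x = loop_field u v k (pi_t f) x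
    + deriv_op u (- k) (pi_t (coord_op v 1 f)) x - (if u = v \<and> k = 0 then pi_t f x else 0)"
proof -
  let ?e = "deriv_op u (- k) (pi_t (coord_op v 1 f)) x - (if u = v \<and> k = 0 then pi_t f x else 0)"
  have termwise: "pi_t (coord_op v (a + k) (deriv_op u a f)) x
      = coord_op v ((a - 1) + k) (deriv_op u (a - 1) (pi_t f)) x + (if a = 1 - k then ?e else 0)" for a
  proof (cases "a = 1 - k")
    case False
    then show ?thesis
      by (simp add: pi_t_coord_op pi_t_deriv_op[OF f] algebra_simps)
  next
    case True
    let ?d = "if u = v \<and> k = 0 then 1 else (0 :: complex)"
    have "coord_op v 1 (deriv_op u a f) = (\<lambda>x. deriv_op u a (coord_op v 1 f) x - ?d * f x)"
      using True by (auto simp: deriv_op_coord_op[OF f] fun_eq_iff)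
    then have "pi_t (coord_op v 1 (deriv_op u a f)) x
        = pi_t (deriv_op u a (coord_op v 1 f)) x - ?d * pi_t f x"
      by (simp only: f local_linear_diff[OF local_linear_pi_t] schwartz_cmult
        pi_t_cmult schwartz_deriv_op schwartz_coord_op)
    moreover have "coord_op v ((a - 1) + k) g x = 0" for g
      using True by (simp add: coord_op_def)
    ultimately show ?thesis
      using True by (simp add: pi_t_deriv_op[OF schwartz_coord_op[OF f]])
  qed
  have "pi_t (loop_field u v k f) x = Sum_any (\<lambda>a. pi_t (coord_op v (a + k) (deriv_op u a f)) x)"
    unfolding loop_field_def
    by (subst local_linear_Sum_any(2)[OF local_linear_pi_t loop_field_locally_finite])
       (simp_all add: f schwartz_coord_op schwartz_deriv_op)
  also have "\<dots> = Sum_any (\<lambda>a. coord_op v ((a - 1) + k) (deriv_op u (a - 1) (pi_t f)) x + (if a = 1 - k then ?e else 0))"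
    by (simp only: termwise)
  also have "\<dots> = Sum_any (\<lambda>a. coord_op v ((a - 1) + k) (deriv_op u (a - 1) (pi_t f)) x) + ?e"
  proof (subst Sum_any.distrib)
    show "finite {a. coord_op v ((a - 1) + k) (deriv_op u (a - 1) (pi_t f)) x \<noteq> 0}"
      by (rule finite_shift) (rule loop_field_finite_support)
  qed auto
  also have "Sum_any (\<lambda>a. coord_op v ((a - 1) + k) (deriv_op u (a - 1) (pi_t f)) x) = loop_field u v k (pi_t f) x"
    unfolding loop_field_def
    by (rule Sum_any.reindex_cong[of "\<lambda>b. b + 1"])
       (auto simp: fun_eq_iff intro!: o_bij[of "\<lambda>b. b - 1"])
  finally show ?thesis by simp
qed

lemma pi_t_pow_deriv_op_eq_0:
  assumes "f \<in> schwartz_space" "a \<le> int j"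
  shows "(pi_t ^^ j) (deriv_op u a f) x = 0"
  using assms by (simp add: pi_t_pow_deriv_op deriv_op_nonpos)

text \<open>
  The first error term of \<open>pi_t_loop_field\<close> is a derivative of index \<open>- k\<close>, and \<open>j\<close> integrations
  annihilate it.
\<close>

lemma pi_t_pow_loop_field_pi_t:
  assumes f: "f \<in> schwartz_space" and j: "- k \<le> int j"
  shows "(pi_t ^^ j) (loop_field u v k (pi_t f)) x
    = (pi_t ^^ Suc j) (loop_field u v k f) x + (if u = v \<and> k = 0 then (pi_t ^^ Suc j) f x else 0)"
proof -
  let ?D = "deriv_op u (- k) (pi_t (coord_op v 1 f))"
  let ?d = "if u = v \<and> k = 0 then 1 else (0 :: complex)"
  have S: "pi_t (coord_op v 1 f) \<in> schwartz_space" "pi_t f \<in> schwartz_space"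
      "pi_t (loop_field u v k f) \<in> schwartz_space" "?D \<in> schwartz_space"
    by (intro schwartz_deriv_op schwartz_pi_t schwartz_coord_op schwartz_loop_field f)+
  have "loop_field u v k (pi_t f) = (\<lambda>x. (pi_t (loop_field u v k f) x + ?d * pi_t f x) - ?D x)"
    by (auto simp: pi_t_loop_field[OF f] fun_eq_iff)
  then have "(pi_t ^^ j) (loop_field u v k (pi_t f)) x
     = ((pi_t ^^ j) (pi_t (loop_field u v k f)) x + ?d * (pi_t ^^ j) (pi_t f) x) - (pi_t ^^ j) ?D x"
    by (simp only: S local_linear_diff[OF local_linear_pi_t_pow] local_linear_add[OF local_linear_pi_t_pow]
      local_linear_cmult[OF local_linear_pi_t_pow] schwartz_add schwartz_cmult)
  also have "(pi_t ^^ j) ?D x = 0"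
    using j by (rule pi_t_pow_deriv_op_eq_0[OF S(1)])
  finally show ?thesis by (simp add: funpow_swap1)
qed

lemma schwartz_loop_field_from:
  assumes f: "f \<in> schwartz_space"
  shows "loop_field_from m u v k f \<in> schwartz_space"
proof (cases "m \<ge> 1")
  case True
  have "(\<lambda>x. \<Sum>a\<in>{1..<m}. coord_op v (a + k) (deriv_op u a f) x) \<in> schwartz_space"
    by (intro schwartz_sum schwartz_coord_op schwartz_deriv_op f)
  from schwartz_add[OF schwartz_loop_field[OF f] schwartz_cmult[OF this, of "-1"]]
  have "(\<lambda>x. loop_field u v k f x - (\<Sum>a\<in>{1..<m}. coord_op v (a + k) (deriv_op u a f) x)) \<in> schwartz_space"
    by simp
  then show ?thesis by (simp add: loop_field_eq_loop_field_from[OF True, of u v k f])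
qed (simp add: loop_field_from_le_1 schwartz_loop_field f)

text \<open>
  In the terms with \<open>a < m\<close> the derivative is taken in a variable that is integrated out. Moving it
  to the left makes the term a total derivative, at the cost of \<open>- f\<close> if the coefficient is the same
  variable. There are \<open>m - 1\<close> such terms.
\<close>

lemma pi_t_pow_loop_field_from:
  assumes f: "f \<in> schwartz_space" and L: "m \<le> int L + 1" and m: "m \<ge> 1"
  shows "(pi_t ^^ L) (loop_field_from m u v k f) x = (pi_t ^^ L) (loop_field u v k f) x
      + (if u = v \<and> k = 0 then of_int (m - 1) * (pi_t ^^ L) f x else 0)"
proof -
  let ?h = "\<lambda>a. coord_op v (a + k) (deriv_op u a f)"
  have S: "?h a \<in> schwartz_space" for a
    by (intro schwartz_coord_op schwartz_deriv_op f)
  have eq: "loop_field_from m u v k f = (\<lambda>x. loop_field u v k f x - (\<Sum>a\<in>{1..<m}. ?h a x))"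
    by (simp add: loop_field_eq_loop_field_from[OF m] fun_eq_iff)
  have S': "(\<lambda>x. \<Sum>a\<in>{1..<m}. ?h a x) \<in> schwartz_space"
    by (rule schwartz_sum) (rule S)
  have termwise: "(pi_t ^^ L) (?h a) x = - (if u = v \<and> k = 0 then (pi_t ^^ L) f x else 0)" if a: "a \<in> {1..<m}" for a
  proof -
    let ?d = "if u = v \<and> k = 0 then 1 else (0 :: complex)"
    have "?h a = (\<lambda>x. deriv_op u a (coord_op v (a + k) f) x - ?d * f x)"
      using a by (auto simp: deriv_op_coord_op[OF f] fun_eq_iff)
    then have "(pi_t ^^ L) (?h a) x = (pi_t ^^ L) (deriv_op u a (coord_op v (a + k) f)) x - ?d * (pi_t ^^ L) f x"
      by (simp only: f local_linear_diff[OF local_linear_pi_t_pow] schwartz_cmult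
        local_linear_cmult[OF local_linear_pi_t_pow] schwartz_deriv_op schwartz_coord_op)
    moreover have "(pi_t ^^ L) (deriv_op u a (coord_op v (a + k) f)) x = 0"
      using a L by (intro pi_t_pow_deriv_op_eq_0 schwartz_coord_op f) auto
    ultimately show ?thesis by simp
  qed
  have "(pi_t ^^ L) (loop_field_from m u v k f) x
      = (pi_t ^^ L) (loop_field u v k f) x - (\<Sum>a\<in>{1..<m}. (pi_t ^^ L) (?h a) x)"
    unfolding eq
    by (simp only: local_linear_diff[OF local_linear_pi_t_pow schwartz_loop_field[OF f] S']
      local_linear_sum[OF local_linear_pi_t_pow S])
  also have "(\<Sum>a\<in>{1..<m}. (pi_t ^^ L) (?h a) x)
      = (\<Sum>a\<in>{1..<m}. - (if u = v \<and> k = 0 then (pi_t ^^ L) f x else 0))"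
    by (intro sum.cong termwise refl)
  finally show "(pi_t ^^ L) (loop_field_from m u v k f) x = (pi_t ^^ L) (loop_field u v k f) x
      + (if u = v \<and> k = 0 then of_int (m - 1) * (pi_t ^^ L) f x else 0)"
    using m by (simp add: of_nat_nat)
qed

lemma pi_t_pow_loop_field_from_Suc:
  assumes f: "f \<in> schwartz_space" and L: "- l \<le> int L"
  shows "(pi_t ^^ L) (loop_field_from (1 - l) u v k f) x = (pi_t ^^ L) (loop_field u v k f) x
      + (if u = v \<and> k = 0 then of_int (max 0 (- l)) * (pi_t ^^ L) f x else 0)"
proof -
  have *: "loop_field_from (1 - l) u v k f = loop_field_from (1 + max 0 (- l)) u v k f"
    by (cases "l \<ge> 0") (simp_all add: loop_field_from_le_1)
  show "(pi_t ^^ L) (loop_field_from (1 - l) u v k f) x = (pi_t ^^ L) (loop_field u v k f) x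
      + (if u = v \<and> k = 0 then of_int (max 0 (- l)) * (pi_t ^^ L) f x else 0)"
    unfolding * using L by (subst pi_t_pow_loop_field_from[OF f]) auto
qed

text \<open>
  This is where the central charge appears: the two truncations at \<open>1 - l\<close> and \<open>1 - k\<close> contribute
  \<open>max 0 (- l)\<close> and \<open>max 0 (- k)\<close>, and for \<open>l = - k\<close> the difference is \<open>k\<close>.
\<close>

lemma pi_t_pow_loop_field_commutator:
  assumes f: "f \<in> schwartz_space" and L: "- k \<le> int L" "- l \<le> int L"
  shows "(pi_t ^^ L) (loop_field u v k (loop_field u' v' l f)) x - (pi_t ^^ L) (loop_field u' v' l (loop_field u v k f)) x
    = (if u = v' then (pi_t ^^ L) (loop_field u' v (k + l) f) x else 0)
    - (if u' = v then (pi_t ^^ L) (loop_field u v' (k + l) f) x else 0)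
    + (if u = v' \<and> u' = v \<and> k + l = 0 then of_int k * (pi_t ^^ L) f x else 0)"
proof -
  let ?d = "\<lambda>b. if b then 1 else (0 :: complex)"
  let ?P = "pi_t ^^ L"
  note S = f schwartz_loop_field[OF f] schwartz_loop_field[OF schwartz_loop_field[OF f]] schwartz_loop_field_from[OF f]
  have "(\<lambda>x. loop_field u v k (loop_field u' v' l f) x + ?d (u' = v) * loop_field_from (1 - k) u v' (k + l) f x)
    = (\<lambda>x. loop_field u' v' l (loop_field u v k f) x + ?d (u = v') * loop_field_from (1 - l) u' v (k + l) f x)"
    using loop_field_loop_field[OF f, of u v k u' v' l] by (cases "u' = v"; cases "u = v'") (simp_all add: fun_eq_iff)
  from fun_cong[OF arg_cong[OF this, of ?P], of x]
  have "?P (loop_field u v k (loop_field u' v' l f)) x + ?d (u' = v) * ?P (loop_field_from (1 - k) u v' (k + l) f) x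
    = ?P (loop_field u' v' l (loop_field u v k f)) x + ?d (u = v') * ?P (loop_field_from (1 - l) u' v (k + l) f) x"
    by (simp only: S local_linear_add[OF local_linear_pi_t_pow] schwartz_cmult
        local_linear_cmult[OF local_linear_pi_t_pow])
  then have "?P (loop_field u v k (loop_field u' v' l f)) x - ?P (loop_field u' v' l (loop_field u v k f)) x
    = ?d (u = v') * ?P (loop_field_from (1 - l) u' v (k + l) f) x
    - ?d (u' = v) * ?P (loop_field_from (1 - k) u v' (k + l) f) x"
    by (simp add: algebra_simps)
  also have "\<dots> = ?d (u = v') * (?P (loop_field u' v (k + l) f) x
       + (if u' = v \<and> k + l = 0 then of_int (max 0 (- l)) * ?P f x else 0))
    - ?d (u' = v) * (?P (loop_field u v' (k + l) f) x
       + (if u = v' \<and> k + l = 0 then of_int (max 0 (- k)) * ?P f x else 0))"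
    by (simp only: pi_t_pow_loop_field_from_Suc[OF f L(1)] pi_t_pow_loop_field_from_Suc[OF f L(2)])
  also have "\<dots> = (if u = v' then ?P (loop_field u' v (k + l) f) x else 0)
    - (if u' = v then ?P (loop_field u v' (k + l) f) x else 0)
    + (if u = v' \<and> u' = v \<and> k + l = 0 then (of_int (max 0 (- l)) - of_int (max 0 (- k))) * ?P f x else 0)"
    by (simp add: algebra_simps)
  also have "(if u = v' \<and> u' = v \<and> k + l = 0 then (of_int (max 0 (- l)) - of_int (max 0 (- k))) * ?P f x else 0)
    = (if u = v' \<and> u' = v \<and> k + l = 0 then of_int k * ?P f x else 0)"
  proof -
    have "of_int (max 0 (- l)) - of_int (max 0 (- k)) = (of_int k :: complex)" if "k + l = 0"
    proof -
      have "max 0 (- l) - max 0 (- k) = k" using that by auto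
      then show ?thesis by (metis of_int_diff)
    qed
    then show ?thesis by auto
  qed
  finally show ?thesis .
qed


section \<open>Matrix combinations of the vector fields\<close>

definition mat_field :: "complex^'n^'n \<Rightarrow> int \<Rightarrow> ('n::finite rminus \<Rightarrow> complex) \<Rightarrow> 'n rminus \<Rightarrow> complex" where
  "mat_field A k f = (\<lambda>x. \<Sum>u\<in>UNIV. \<Sum>v\<in>UNIV. A $ u $ v * loop_field u v k f x)"

lemma local_linear_mat_field: "local_linear (mat_field A k)"
proof -
  have "local_linear (\<lambda>f x. \<Sum>v\<in>UNIV. A $ u $ v * loop_field u v k f x)" for u
    by (rule local_linear_lincomb) (rule local_linear_loop_field)
  from local_linear_lincomb[where c = "\<lambda>_. 1", OF this] show ?thesis
    by (simp add: mat_field_def[abs_def])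
qed

lemmas schwartz_mat_field = local_linear_closed[OF local_linear_mat_field]

lemma local_linear_apply_mat_field:
  assumes F: "local_linear F" and f: "f \<in> schwartz_space"
  shows "F (mat_field A k f) = (\<lambda>x. \<Sum>u\<in>UNIV. \<Sum>v\<in>UNIV. A $ u $ v * F (loop_field u v k f) x)"
  unfolding mat_field_def
  by (simp add: local_linear_sum[OF F] local_linear_cmult[OF F] schwartz_sum schwartz_cmult
      schwartz_loop_field f)

lemma mat_field_add: "mat_field (A + B) k f x = mat_field A k f x + mat_field B k f x"
  by (simp add: mat_field_def distrib_right sum.distrib)

lemma mat_field_scale: "mat_field (map_matrix ((*) c) A) k f x = c * mat_field A k f x"
  by (simp add: mat_field_def map_matrix_def sum_distrib_left mult.assoc)

lemma sum_diag:
  fixes A :: "complex^'n^'n::finite"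
  shows "(\<Sum>u\<in>UNIV. \<Sum>v\<in>UNIV. A $ u $ v * (if u = v \<and> b then q else 0)) = (if b then trace A * q else 0)"
  by (simp add: trace_def sum_distrib_right if_distrib[of "(*) _"] cong: if_cong)

text \<open>
  The scalars from \<open>pi_t_pow_loop_field_pi_t\<close> add up to a multiple of the trace.
\<close>

lemma pi_t_pow_mat_field_pi_t:
  assumes f: "f \<in> schwartz_space" and j: "- k \<le> int j" and A: "A \<in> sl"
  shows "(pi_t ^^ j) (mat_field A k (pi_t f)) = (pi_t ^^ Suc j) (mat_field A k f)"
proof
  fix x
  have "(pi_t ^^ j) (mat_field A k (pi_t f)) x
      = (\<Sum>u\<in>UNIV. \<Sum>v\<in>UNIV. A $ u $ v * (pi_t ^^ Suc j) (loop_field u v k f) x)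
      + (\<Sum>u\<in>UNIV. \<Sum>v\<in>UNIV. A $ u $ v * (if u = v \<and> k = 0 then (pi_t ^^ Suc j) f x else 0))"
    by (simp only: local_linear_apply_mat_field[OF local_linear_pi_t_pow schwartz_pi_t[OF f]]
        pi_t_pow_loop_field_pi_t[OF f j] distrib_left sum.distrib)
  also have "\<dots> = (pi_t ^^ Suc j) (mat_field A k f) x"
    using A by (simp only: local_linear_apply_mat_field[OF local_linear_pi_t_pow f] sum_diag)
      (simp add: sl_def)
  finally show "(pi_t ^^ j) (mat_field A k (pi_t f)) x = (pi_t ^^ Suc j) (mat_field A k f) x" .
qed

lemma schwartz_pi_t_pow: "f \<in> schwartz_space \<Longrightarrow> (pi_t ^^ j) f \<in> schwartz_space"
  by (rule local_linear_closed[OF local_linear_pi_t_pow])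

lemma pi_t_pow_mat_field_pi_t_pow:
  assumes f: "f \<in> schwartz_space" and j: "- k \<le> int j" and A: "A \<in> sl"
  shows "(pi_t ^^ j) (mat_field A k ((pi_t ^^ i) f)) = (pi_t ^^ (j + i)) (mat_field A k f)"
  using j
proof (induction i arbitrary: j)
  case (Suc i)
  have "(pi_t ^^ j) (mat_field A k (pi_t ((pi_t ^^ i) f))) = (pi_t ^^ Suc j) (mat_field A k ((pi_t ^^ i) f))"
    by (intro pi_t_pow_mat_field_pi_t schwartz_pi_t_pow f Suc.prems A)
  also have "\<dots> = (pi_t ^^ (Suc j + i)) (mat_field A k f)"
    using Suc.prems by (intro Suc.IH) simp
  finally show ?case by simp
qed simp

text \<open>
  Bilinear extension of the commutator formula for matrix units to arbitrary matrices. The sign is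
  reversed because sending \<open>E\<^sub>u\<^sub>v\<close> to \<open>x\<^sup>v \<partial>\<^sub>x\<^sup>u\<close> reverses commutators.
\<close>

lemma sum_commutator:
  fixes A B :: "complex^'n^'n::finite"
  assumes "\<And>u v u' v'. X u v u' v' - Y u v u' v' = (if u = v' then P u' v else 0)
    - (if u' = v then P u v' else 0) + (if u = v' \<and> u' = v then z else (0::complex))"
  shows "(\<Sum>u\<in>UNIV. \<Sum>v\<in>UNIV. A $ u $ v * (\<Sum>u'\<in>UNIV. \<Sum>v'\<in>UNIV. B $ u' $ v' * X u v u' v'))
    - (\<Sum>u'\<in>UNIV. \<Sum>v'\<in>UNIV. B $ u' $ v' * (\<Sum>u\<in>UNIV. \<Sum>v\<in>UNIV. A $ u $ v * Y u v u' v'))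
    = - (\<Sum>u\<in>UNIV. \<Sum>v\<in>UNIV. commutator A B $ u $ v * P u v) + trace (A ** B) * z"
proof -
  let ?S = "\<lambda>W. \<Sum>u\<in>UNIV. \<Sum>v\<in>UNIV. \<Sum>u'\<in>UNIV. \<Sum>v'\<in>UNIV. A $ u $ v * B $ u' $ v' * (W u v u' v' :: complex)"
  have 1: "(\<Sum>u\<in>UNIV. \<Sum>v\<in>UNIV. A $ u $ v * (\<Sum>u'\<in>UNIV. \<Sum>v'\<in>UNIV. B $ u' $ v' * X u v u' v')) = ?S X"
    by (simp add: sum_distrib_left mult.assoc)
  have 2: "(\<Sum>u'\<in>UNIV. \<Sum>v'\<in>UNIV. B $ u' $ v' * (\<Sum>u\<in>UNIV. \<Sum>v\<in>UNIV. A $ u $ v * Y u v u' v')) = ?S Y"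
  proof -
    have pair: "(\<Sum>a\<in>UNIV. \<Sum>b\<in>UNIV. g a b) = (\<Sum>p\<in>UNIV. g (fst p) (snd p))"
      for g :: "'n \<Rightarrow> 'n \<Rightarrow> complex"
      by (simp add: sum.cartesian_product UNIV_Times_UNIV case_prod_unfold)
    have "(\<Sum>u'\<in>UNIV. \<Sum>v'\<in>UNIV. B $ u' $ v' * (\<Sum>u\<in>UNIV. \<Sum>v\<in>UNIV. A $ u $ v * Y u v u' v'))
       = (\<Sum>u'\<in>UNIV. \<Sum>v'\<in>UNIV. \<Sum>u\<in>UNIV. \<Sum>v\<in>UNIV. A $ u $ v * B $ u' $ v' * Y u v u' v')"
      by (simp add: sum_distrib_left mult_ac)
    also have "\<dots> = ?S Y"
      unfolding pair by (rule sum.swap)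
    finally show ?thesis .
  qed
  have "?S X - ?S Y = ?S (\<lambda>u v u' v'. X u v u' v' - Y u v u' v')"
    by (simp add: right_diff_distrib sum_subtractf)
  also have "\<dots> = ?S (\<lambda>u v u' v'. if u = v' then P u' v else 0)
    - ?S (\<lambda>u v u' v'. if u' = v then P u v' else 0) + ?S (\<lambda>u v u' v'. if u = v' \<and> u' = v then z else 0)"
    unfolding assms by (simp only: right_diff_distrib distrib_left sum_subtractf sum.distrib)
  also have "?S (\<lambda>u v u' v'. if u = v' then P u' v else 0)
    = (\<Sum>u\<in>UNIV. \<Sum>v\<in>UNIV. \<Sum>u'\<in>UNIV. A $ u $ v * B $ u' $ u * P u' v)"
    by (simp add: if_distrib[of "(*) _"] cong: if_cong)
  also have "\<dots> = (\<Sum>u'\<in>UNIV. \<Sum>v\<in>UNIV. \<Sum>u\<in>UNIV. A $ u $ v * B $ u' $ u * P u' v)"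
  proof -
    let ?W = "\<lambda>u v u'. A $ u $ v * B $ u' $ u * P u' v"
    have "(\<Sum>u\<in>UNIV. \<Sum>v\<in>UNIV. \<Sum>u'\<in>UNIV. ?W u v u') = (\<Sum>v\<in>UNIV. \<Sum>u\<in>UNIV. \<Sum>u'\<in>UNIV. ?W u v u')"
      by (rule sum.swap)
    also have "\<dots> = (\<Sum>v\<in>UNIV. \<Sum>u'\<in>UNIV. \<Sum>u\<in>UNIV. ?W u v u')"
      by (rule sum.cong[OF refl]) (rule sum.swap)
    also have "\<dots> = (\<Sum>u'\<in>UNIV. \<Sum>v\<in>UNIV. \<Sum>u\<in>UNIV. ?W u v u')"
      by (rule sum.swap)
    finally show ?thesis .
  qed
  also have "\<dots> = (\<Sum>u\<in>UNIV. \<Sum>v\<in>UNIV. (B ** A) $ u $ v * P u v)"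
  proof -
    have "(\<Sum>k\<in>UNIV. A $ k $ v * B $ u $ k * P u v) = (B ** A) $ u $ v * P u v" for u v
    proof -
      have "(B ** A) $ u $ v = (\<Sum>k\<in>UNIV. A $ k $ v * B $ u $ k)"
        unfolding matrix_matrix_mult_def by (simp add: mult.commute)
      then show ?thesis by (simp add: sum_distrib_right)
    qed
    then show ?thesis by (simp only:)
  qed
  also have "?S (\<lambda>u v u' v'. if u' = v then P u v' else 0)
    = (\<Sum>u\<in>UNIV. \<Sum>v\<in>UNIV. \<Sum>v'\<in>UNIV. A $ u $ v * B $ v $ v' * P u v')"
  proof -
    have "(\<Sum>u'\<in>UNIV. \<Sum>v'\<in>UNIV. A $ u $ v * B $ u' $ v' * (if u' = v then P u v' else 0))
        = (\<Sum>v'\<in>UNIV. A $ u $ v * B $ v $ v' * P u v')" for u v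
      by (subst sum.swap) (simp add: if_distrib[of "(*) _"] cong: if_cong)
    then show ?thesis by (simp only:)
  qed
  also have "\<dots> = (\<Sum>u\<in>UNIV. \<Sum>v'\<in>UNIV. \<Sum>v\<in>UNIV. A $ u $ v * B $ v $ v' * P u v')"
    by (rule sum.cong[OF refl]) (rule sum.swap)
  also have "\<dots> = (\<Sum>u\<in>UNIV. \<Sum>v\<in>UNIV. (A ** B) $ u $ v * P u v)"
    by (simp add: matrix_matrix_mult_def sum_distrib_right)
  also have "?S (\<lambda>u v u' v'. if u = v' \<and> u' = v then z else 0) = trace (A ** B) * z"
  proof -
    have "(\<Sum>u'\<in>UNIV. \<Sum>v'\<in>UNIV. A $ u $ v * B $ u' $ v' * (if u = v' \<and> u' = v then z else 0))
        = A $ u $ v * B $ v $ u * z" for u v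
    proof -
      have "A $ u $ v * B $ u' $ v' * (if u = v' \<and> u' = v then z else 0)
        = (if v' = u then if u' = v then A $ u $ v * B $ v $ u * z else 0 else 0)" for u' v'
        by auto
      then show ?thesis by simp
    qed
    then show ?thesis by (simp add: trace_def matrix_matrix_mult_def sum_distrib_right)
  qed
  finally show ?thesis
    unfolding 1 2 commutator_def by (simp add: left_diff_distrib sum_subtractf)
qed

lemma pi_t_pow_mat_field_commutator:
  assumes f: "f \<in> schwartz_space" and L: "- k \<le> int L" "- l \<le> int L"
  shows "(pi_t ^^ L) (mat_field A k (mat_field B l f)) x - (pi_t ^^ L) (mat_field B l (mat_field A k f)) x
    = - (pi_t ^^ L) (mat_field (commutator A B) (k + l) f) x
      + (if k + l = 0 then of_int k * trace (A ** B) * (pi_t ^^ L) f x else 0)"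
proof -
  let ?P = "pi_t ^^ L"
  have ll: "local_linear (\<lambda>f. ?P (loop_field u v k f))" for u v k
    by (rule local_linear_compose[OF local_linear_pi_t_pow local_linear_loop_field])
  have expand: "?P (mat_field A k (mat_field B l f)) x
    = (\<Sum>u\<in>UNIV. \<Sum>v\<in>UNIV. A $ u $ v * (\<Sum>u'\<in>UNIV. \<Sum>v'\<in>UNIV. B $ u' $ v' * ?P (loop_field u v k (loop_field u' v' l f)) x))"
    for A B k l
    by (simp only: local_linear_apply_mat_field[OF local_linear_pi_t_pow schwartz_mat_field[OF f]]
        local_linear_apply_mat_field[OF ll f])
  have "?P (mat_field A k (mat_field B l f)) x - ?P (mat_field B l (mat_field A k f)) x
     = - (\<Sum>u\<in>UNIV. \<Sum>v\<in>UNIV. commutator A B $ u $ v * ?P (loop_field u v (k + l) f) x)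
       + trace (A ** B) * (if k + l = 0 then of_int k * ?P f x else 0)"
    unfolding expand
    by (rule sum_commutator) (auto simp: pi_t_pow_loop_field_commutator[OF f L])
  then show ?thesis
    by (simp add: local_linear_apply_mat_field[OF local_linear_pi_t_pow f] mult_ac)
qed


section \<open>The action on an eigenspace\<close>

text \<open>
  The uniform formula for the action of \<open>A t\<^sup>k\<close>; the exponent \<open>nat (- k)\<close> is \<open>0\<close> for \<open>k \<ge> 0\<close> and \<open>- k\<close>
  otherwise.
\<close>

definition loop_action :: "complex \<Rightarrow> complex^'n^'n \<Rightarrow> int \<Rightarrow> ('n::finite rminus \<Rightarrow> complex) \<Rightarrow> 'n rminus \<Rightarrow> complex" where
  "loop_action lam A k f = (\<lambda>x. - (lam powi (- int (nat (- k)))) * (pi_t ^^ nat (- k)) (mat_field A k f) x)"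

lemma eigenspaceD:
  assumes "f \<in> eigenspace lam"
  shows "f \<in> schwartz_space" "pi_t f = (\<lambda>x. lam * f x)" "(pi_t ^^ j) f = (\<lambda>x. lam ^ j * f x)"
proof -
  show f: "f \<in> schwartz_space" "pi_t f = (\<lambda>x. lam * f x)"
    using assms by (auto simp: eigenspace_def)
  show "(pi_t ^^ j) f = (\<lambda>x. lam ^ j * f x)"
  proof (induction j)
    case (Suc j)
    have "(pi_t ^^ Suc j) f = pi_t ((pi_t ^^ j) f)" by simp
    also have "\<dots> = (\<lambda>x. lam ^ j * pi_t f x)" unfolding Suc by (rule pi_t_cmult)
    also have "\<dots> = (\<lambda>x. lam ^ Suc j * f x)" unfolding f(2) by (simp add: mult_ac)
    finally show ?case .
  qed simp
qed

text \<open>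
  On an eigenspace the number of integrations may be increased at will, since each further one is
  compensated by a factor \<open>lam\<close>.
\<close>

lemma loop_action_eq:
  assumes lam: "lam \<noteq> 0" and f: "f \<in> eigenspace lam" and A: "A \<in> sl" and L: "- k \<le> int L"
  shows "loop_action lam A k f = (\<lambda>x. - (lam powi (- int L)) * (pi_t ^^ L) (mat_field A k f) x)"
proof -
  define j where "j = nat (- k)"
  define i where "i = L - j"
  have L': "L = j + i" using L by (simp add: i_def j_def)
  have "(pi_t ^^ L) (mat_field A k f) = (pi_t ^^ j) (mat_field A k ((pi_t ^^ i) f))"
    unfolding L' by (subst pi_t_pow_mat_field_pi_t_pow) (use f A in \<open>auto simp: j_def eigenspaceD\<close>)
  also have "\<dots> = (\<lambda>x. lam ^ i * (pi_t ^^ j) (mat_field A k f) x)"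
    by (simp only: eigenspaceD[OF f] local_linear_cmult[OF local_linear_mat_field]
        local_linear_cmult[OF local_linear_pi_t_pow] schwartz_mat_field)
  moreover have "lam powi (- int L) * lam ^ i = lam powi (- int j)"
  proof -
    have "lam powi (- int n) = inverse (lam ^ n)" for n by (simp add: power_int_minus)
    then show ?thesis using lam by (simp only: L' power_add) simp
  qed
  ultimately show ?thesis
    by (simp add: loop_action_def j_def[symmetric] fun_eq_iff mult.assoc[symmetric])
qed

lemma eigenspace_cmult: "f \<in> eigenspace lam \<Longrightarrow> (\<lambda>x. c * f x) \<in> eigenspace lam"
  by (auto simp: eigenspace_def schwartz_cmult pi_t_cmult mult_ac)

lemma eigenspace_add: "f \<in> eigenspace lam \<Longrightarrow> g \<in> eigenspace lam \<Longrightarrow> (\<lambda>x. f x + g x) \<in> eigenspace lam"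
  by (auto simp: eigenspace_def schwartz_add pi_t_add distrib_left)

lemma loop_action_eigenspace:
  assumes f: "f \<in> eigenspace lam" and A: "A \<in> sl"
  shows "loop_action lam A k f \<in> eigenspace lam"
proof -
  let ?j = "nat (- k)"
  let ?g = "(pi_t ^^ ?j) (mat_field A k f)"
  note S = eigenspaceD(1)[OF f]
  have "pi_t ?g = (pi_t ^^ Suc ?j) (mat_field A k f)" by simp
  also have "\<dots> = (pi_t ^^ ?j) (mat_field A k (pi_t f))"
    by (rule pi_t_pow_mat_field_pi_t[OF S _ A, symmetric]) simp
  also have "\<dots> = (\<lambda>x. lam * ?g x)"
    by (simp only: eigenspaceD(2)[OF f] S local_linear_cmult[OF local_linear_mat_field]
        local_linear_cmult[OF local_linear_pi_t_pow] schwartz_mat_field)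
  finally have "?g \<in> eigenspace lam"
    using S by (simp add: eigenspace_def schwartz_pi_t_pow schwartz_mat_field)
  then show ?thesis unfolding loop_action_def by (rule eigenspace_cmult)
qed

text \<open>
  With sufficiently many integrations both products become integrals of products of fields.
\<close>

lemma loop_action_commutator:
  assumes lam: "lam \<noteq> 0" and f: "f \<in> eigenspace lam" and A: "A \<in> sl" and B: "B \<in> sl"
  shows "loop_action lam A k (loop_action lam B l f) x - loop_action lam B l (loop_action lam A k f) x
    = loop_action lam (commutator A B) (k + l) f x
      + (if k + l = 0 then of_int k * trace (A ** B) * f x else 0)"
proof -
  define N where "N = nat \<bar>k\<bar> + nat \<bar>l\<bar>"
  define c where "c = lam powi (- int N)"
  note S = eigenspaceD(1)[OF f]
  have double: "loop_action lam A k (loop_action lam B l f) x = c * c * (pi_t ^^ (N + N)) (mat_field A k (mat_field B l f)) x"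
    if A: "A \<in> sl" and B: "B \<in> sl" and kl: "- k \<le> int N" "- l \<le> int N" for A B k l
  proof -
    let ?g = "(pi_t ^^ N) (mat_field B l f)"
    have g: "loop_action lam B l f = (\<lambda>x. - c * ?g x)"
      using loop_action_eq[OF lam f B kl(2)] by (simp add: c_def)
    have "loop_action lam A k (loop_action lam B l f) x = - c * (pi_t ^^ N) (mat_field A k (loop_action lam B l f)) x"
      using loop_action_eq[OF lam loop_action_eigenspace[OF f B] A kl(1)] by (simp add: c_def)
    also have "\<dots> = - c * (- c * (pi_t ^^ N) (mat_field A k ?g) x)"
      by (simp only: g local_linear_cmult[OF local_linear_mat_field] schwartz_pi_t_pow
        local_linear_cmult[OF local_linear_pi_t_pow] schwartz_mat_field S)
    also have "(pi_t ^^ N) (mat_field A k ?g) = (pi_t ^^ (N + N)) (mat_field A k (mat_field B l f))"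
      by (intro pi_t_pow_mat_field_pi_t_pow schwartz_mat_field S kl A)
    finally show ?thesis by simp
  qed
  have N: "- k \<le> int N" "- l \<le> int N" "- (k + l) \<le> int (N + N)"
    by (auto simp: N_def)
  have comm: "commutator A B \<in> sl"
    by (simp add: sl_def commutator_def trace_sub trace_mul_sym[of A B])
  have cc: "c * c = lam powi (- int (N + N))"
    using lam by (simp add: c_def power_int_add[symmetric])
  have "loop_action lam A k (loop_action lam B l f) x - loop_action lam B l (loop_action lam A k f) x
    = c * c * ((pi_t ^^ (N + N)) (mat_field A k (mat_field B l f)) x
      - (pi_t ^^ (N + N)) (mat_field B l (mat_field A k f)) x)"
    by (simp add: double A B N right_diff_distrib)
  also have "\<dots> = - (c * c) * (pi_t ^^ (N + N)) (mat_field (commutator A B) (k + l) f) x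
      + (if k + l = 0 then of_int k * trace (A ** B) * (c * c * (pi_t ^^ (N + N)) f x) else 0)"
    using N by (subst pi_t_pow_mat_field_commutator[OF S]) (auto simp: algebra_simps)
  also have "- (c * c) * (pi_t ^^ (N + N)) (mat_field (commutator A B) (k + l) f) x = loop_action lam (commutator A B) (k + l) f x"
    by (simp only: loop_action_eq[OF lam f comm N(3)] cc)
  also have "c * c * (pi_t ^^ (N + N)) f x = f x"
  proof -
    have "c * lam ^ N = 1" using lam by (simp add: c_def power_int_minus)
    then have "(c * lam ^ N) * (c * lam ^ N) * f x = f x" by simp
    moreover have "c * c * (lam ^ (N + N) * f x) = (c * lam ^ N) * (c * lam ^ N) * f x"
      by (simp add: power_add mult_ac)
    ultimately show ?thesis by (simp only: eigenspaceD(3)[OF f])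
  qed
  finally show ?thesis .
qed


section \<open>The representation of the affine algebra\<close>

lemma local_linear_loop_action: "local_linear (loop_action lam A k)"
  unfolding loop_action_def[abs_def]
  by (intro local_linear_scale local_linear_compose[OF local_linear_pi_t_pow local_linear_mat_field])

lemma loop_action_add_matrix:
  assumes f: "f \<in> schwartz_space"
  shows "loop_action lam (A + B) k f x = loop_action lam A k f x + loop_action lam B k f x"
proof -
  have "mat_field (A + B) k f = (\<lambda>x. mat_field A k f x + mat_field B k f x)"
    by (simp add: mat_field_add fun_eq_iff)
  then show ?thesis
    by (simp add: loop_action_def local_linear_add[OF local_linear_pi_t_pow] schwartz_mat_field f distrib_left)
qed

lemma loop_action_scale_matrix:
  assumes f: "f \<in> schwartz_space"
  shows "loop_action lam (map_matrix ((*) c) A) k f x = c * loop_action lam A k f x"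
proof -
  have "mat_field (map_matrix ((*) c) A) k f = (\<lambda>x. c * mat_field A k f x)"
    by (simp add: mat_field_scale fun_eq_iff)
  then show ?thesis
    by (simp add: loop_action_def local_linear_cmult[OF local_linear_pi_t_pow] schwartz_mat_field f)
qed

lemma loop_action_zero_matrix: "loop_action lam 0 k f x = 0"
proof -
  have "mat_field 0 k f = (\<lambda>x. 0)" by (simp add: mat_field_def fun_eq_iff)
  then show ?thesis by (simp add: loop_action_def local_linear_zero[OF local_linear_pi_t_pow])
qed

definition affine_action :: "complex \<Rightarrow> 'n::finite affine_op" where
  "affine_action lam X f = (\<lambda>x. (\<Sum>m\<in>Poly_Mapping.keys (fst X).
      loop_action lam (Poly_Mapping.lookup (fst X) m) m f x) + snd X * f x)"

lemma affine_action_superset: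
  assumes "finite M" "Poly_Mapping.keys (fst X) \<subseteq> M"
  shows "affine_action lam X f x
    = (\<Sum>m\<in>M. loop_action lam (Poly_Mapping.lookup (fst X) m) m f x) + snd X * f x"
proof -
  have "(\<Sum>m\<in>Poly_Mapping.keys (fst X). loop_action lam (Poly_Mapping.lookup (fst X) m) m f x)
      = (\<Sum>m\<in>M. loop_action lam (Poly_Mapping.lookup (fst X) m) m f x)"
    using assms by (intro sum.mono_neutral_left) (auto simp: in_keys_iff loop_action_zero_matrix)
  then show ?thesis by (simp add: affine_action_def)
qed

lemma affine_action_single:
  "affine_action lam (Poly_Mapping.single m A, c) f x = loop_action lam A m f x + c * f x"
  by (subst affine_action_superset[of "{m}"]) (auto simp: loop_action_zero_matrix)

lemma affine_action_add:
  assumes f: "f \<in> schwartz_space"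
  shows "affine_action lam (X + Y) f x = affine_action lam X f x + affine_action lam Y f x"
proof -
  let ?M = "Poly_Mapping.keys (fst X) \<union> Poly_Mapping.keys (fst Y)"
  have "Poly_Mapping.keys (fst (X + Y)) \<subseteq> ?M"
    by (simp add: Poly_Mapping.keys_add)
  then show ?thesis
    by (subst (1 2 3) affine_action_superset[of ?M])
       (auto simp: lookup_add loop_action_add_matrix[OF f] sum.distrib distrib_right)
qed

lemma affine_action_zero: "affine_action lam 0 f x = 0"
  by (simp add: affine_action_def)

lemma affine_action_sum:
  assumes f: "f \<in> schwartz_space"
  shows "affine_action lam (\<Sum>i\<in>I. X i) f x = (\<Sum>i\<in>I. affine_action lam (X i) f x)"
  by (induction I rule: infinite_finite_induct) (simp_all add: affine_action_zero affine_action_add[OF f])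

lemma lookup_fst_affine_scale:
  "Poly_Mapping.lookup (fst (affine_scale c X)) m = map_matrix ((*) c) (Poly_Mapping.lookup (fst X) m)"
  by (simp add: affine_scale_def Poly_Mapping.map.rep_eq when_def map_matrix_def vec_eq_iff)

lemma affine_action_scale:
  assumes f: "f \<in> schwartz_space"
  shows "affine_action lam (affine_scale c X) f x = c * affine_action lam X f x"
proof -
  have "Poly_Mapping.keys (fst (affine_scale c X)) \<subseteq> Poly_Mapping.keys (fst X)"
    by (auto simp: in_keys_iff lookup_fst_affine_scale map_matrix_def vec_eq_iff)
  then show ?thesis
    by (subst affine_action_superset[of "Poly_Mapping.keys (fst X)"])
       (simp_all add: affine_action_def lookup_fst_affine_scale loop_action_scale_matrix[OF f]
          sum_distrib_left distrib_left affine_scale_def[of c X, THEN arg_cong, of snd] mult.assoc)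
qed

lemma eigenspace_zero: "(\<lambda>x. 0) \<in> eigenspace lam"
  by (simp add: eigenspace_def schwartz_zero pi_t_def fun_eq_iff)

lemma eigenspace_sum: "(\<And>i. i \<in> I \<Longrightarrow> h i \<in> eigenspace lam) \<Longrightarrow> (\<lambda>x. \<Sum>i\<in>I. h i x) \<in> eigenspace lam"
  by (induction I rule: infinite_finite_induct) (auto intro: eigenspace_zero eigenspace_add)

lemma affine_action_eigenspace:
  assumes "X \<in> affine_algebra" "f \<in> eigenspace lam"
  shows "affine_action lam X f \<in> eigenspace lam"
  unfolding affine_action_def using assms
  by (intro eigenspace_add eigenspace_sum eigenspace_cmult loop_action_eigenspace)
     (auto simp: affine_algebra_def)

lemma endomorphism_affine_action:
  fixes X :: "'n::finite loop_ext"
  assumes X: "X \<in> affine_algebra"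
  shows "endomorphism lam (affine_action lam X)"
  unfolding endomorphism_def
proof (intro conjI ballI allI)
  fix f :: "'n rminus \<Rightarrow> complex" assume f: "f \<in> eigenspace lam"
  show "affine_action lam X f \<in> eigenspace lam" by (rule affine_action_eigenspace[OF X f])
  fix g :: "'n rminus \<Rightarrow> complex" assume g: "g \<in> eigenspace lam"
  show "affine_action lam X (\<lambda>x. f x + g x) = (\<lambda>x. affine_action lam X f x + affine_action lam X g x)"
    using eigenspaceD(1)[OF f] eigenspaceD(1)[OF g]
    by (simp add: affine_action_def local_linear_add[OF local_linear_loop_action] sum.distrib distrib_left fun_eq_iff)
next
  fix c and f :: "'n rminus \<Rightarrow> complex" assume f: "f \<in> eigenspace lam"
  show "affine_action lam X (\<lambda>x. c * f x) = (\<lambda>x. c * affine_action lam X f x)"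
    using eigenspaceD(1)[OF f]
    by (simp add: affine_action_def local_linear_cmult[OF local_linear_loop_action] sum_distrib_left
      distrib_left mult.left_commute fun_eq_iff)
qed

lemma affine_action_affine_action:
  assumes f: "f \<in> eigenspace lam"
  shows "affine_action lam X (affine_action lam Y f) x =
    (\<Sum>m\<in>Poly_Mapping.keys (fst X). \<Sum>k\<in>Poly_Mapping.keys (fst Y).
       loop_action lam (Poly_Mapping.lookup (fst X) m) m (loop_action lam (Poly_Mapping.lookup (fst Y) k) k f) x)
    + snd Y * (\<Sum>m\<in>Poly_Mapping.keys (fst X). loop_action lam (Poly_Mapping.lookup (fst X) m) m f x)
    + snd X * affine_action lam Y f x"
proof -
  note S = eigenspaceD(1)[OF f]
  note ll = local_linear_loop_action
  have "loop_action lam A m (affine_action lam Y f) x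
    = (\<Sum>k\<in>Poly_Mapping.keys (fst Y). loop_action lam A m (loop_action lam (Poly_Mapping.lookup (fst Y) k) k f) x)
      + snd Y * loop_action lam A m f x" for A m
    unfolding affine_action_def
    by (simp only: local_linear_add[OF ll] local_linear_sum[OF ll] local_linear_cmult[OF ll]
        schwartz_sum schwartz_cmult local_linear_closed[OF ll] S)
  then show ?thesis
    by (simp add: affine_action_def[of lam X] sum.distrib sum_distrib_left)
qed

lemma affine_action_bracket:
  assumes lam: "lam \<noteq> 0" and f: "f \<in> eigenspace lam"
    and X: "X \<in> affine_algebra" and Y: "Y \<in> affine_algebra"
  shows "affine_action lam (affine_bracket X Y) f x
    = affine_action lam X (affine_action lam Y f) x - affine_action lam Y (affine_action lam X f) x"
proof -
  note S = eigenspaceD(1)[OF f]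
  let ?a = "\<lambda>m. Poly_Mapping.lookup (fst X) m" and ?b = "\<lambda>k. Poly_Mapping.lookup (fst Y) k"
  let ?I = "Poly_Mapping.keys (fst X)" and ?J = "Poly_Mapping.keys (fst Y)"
  have sl: "?a m \<in> sl" "?b k \<in> sl" for m k
    using X Y by (auto simp: affine_algebra_def)
  have "affine_bracket X Y = (\<Sum>m\<in>?I. \<Sum>k\<in>?J. (Poly_Mapping.single (m + k) (commutator (?a m) (?b k)),
      if m + k = 0 then of_int m * trace (?a m ** ?b k) else 0))"
    by (rule prod_eqI) (simp_all add: affine_bracket_def Let_def fst_sum snd_sum)
  then have "affine_action lam (affine_bracket X Y) f x
    = (\<Sum>m\<in>?I. \<Sum>k\<in>?J. loop_action lam (commutator (?a m) (?b k)) (m + k) f x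
      + (if m + k = 0 then of_int m * trace (?a m ** ?b k) else 0) * f x)"
    by (simp only: affine_action_sum[OF S] affine_action_single)
  also have "\<dots> = (\<Sum>m\<in>?I. \<Sum>k\<in>?J. loop_action lam (?a m) m (loop_action lam (?b k) k f) x
      - loop_action lam (?b k) k (loop_action lam (?a m) m f) x)"
    by (intro sum.cong refl) (simp add: loop_action_commutator[OF lam f sl])
  also have "\<dots> = (\<Sum>m\<in>?I. \<Sum>k\<in>?J. loop_action lam (?a m) m (loop_action lam (?b k) k f) x)
      - (\<Sum>k\<in>?J. \<Sum>m\<in>?I. loop_action lam (?b k) k (loop_action lam (?a m) m f) x)"
    by (subst (3) sum.swap) (simp add: sum_subtractf)
  also have "\<dots> = affine_action lam X (affine_action lam Y f) x - affine_action lam Y (affine_action lam X f) x"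
    unfolding affine_action_affine_action[OF f]
    by (simp add: affine_action_def algebra_simps)
  finally show ?thesis .
qed

lemma affine_representation_affine_action:
  "lam \<noteq> 0 \<Longrightarrow> affine_representation lam (affine_action lam)"
  by (auto simp: affine_representation_def affine_linear_def endomorphism_affine_action fun_eq_iff
     affine_action_bracket affine_action_add affine_action_scale eigenspaceD(1))

text \<open>
  This converts the sums over the integers into the series over \<open>1, 2, \<dots>\<close> by which the action is
  prescribed.
\<close>

lemma sums_Sum_any_int:
  fixes h :: "int \<Rightarrow> complex"
  assumes "\<And>a. a < m \<Longrightarrow> h a = 0" "\<And>a. a \<ge> m + int K \<Longrightarrow> h a = 0"
  shows "(\<lambda>i. h (m + int i)) sums Sum_any h"
proof -
  have "bij_betw (\<lambda>i. m + int i) {..<K} {m..<m + int K}"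
    by (rule bij_betw_byWitness[where f' = "\<lambda>a. nat (a - m)"]) auto
  then have "(\<Sum>i<K. h (m + int i)) = sum h {m..<m + int K}"
    by (rule sum.reindex_bij_betw)
  also have "\<dots> = Sum_any h"
  proof (intro Sum_any.expand_superset[symmetric] subsetI)
    fix a assume "a \<in> {a. h a \<noteq> 0}"
    then have "\<not> a < m" "\<not> a \<ge> m + int K" using assms by blast+
    then show "a \<in> {m..<m + int K}" by simp
  qed simp
  finally show ?thesis
    using assms(2) sums_finite[of "{..<K}" "\<lambda>i. h (m + int i)"] by simp
qed

lemma loop_field_nonneg_sums:
  "(\<lambda>i. of_real (coord v (Suc i + j) x) * partial u (Suc i) f x) sums loop_field u v (int j) f x"
proof -
  obtain N where N: "x \<in> level N" using ex_level by blast
  have "(\<lambda>i. coord_op v (1 + int i + int j) (deriv_op u (1 + int i) f) x) sums loop_field u v (int j) f x"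
    unfolding loop_field_def
    by (rule sums_Sum_any_int[where K = N]) (rule coord_op_deriv_op_support[OF N], simp)+
  then show ?thesis
    by (simp add: coord_op_def deriv_op_def nat_add_distrib)
qed

lemma loop_field_neg_sums:
  "(\<lambda>i. of_real (coord v (Suc i) x) * partial u (Suc i + j) f x) sums loop_field u v (- int j) f x"
proof -
  obtain N where N: "x \<in> level N" using ex_level by blast
  have "(\<lambda>i. coord_op v (1 + int j + int i + - int j) (deriv_op u (1 + int j + int i) f) x) sums loop_field u v (- int j) f x"
    unfolding loop_field_def
  proof (rule sums_Sum_any_int[where K = N])
    show "coord_op v (a + - int j) (deriv_op u a f) x = 0" if "a < 1 + int j" for a
      using that by (simp add: coord_op_def)
    show "coord_op v (a + - int j) (deriv_op u a f) x = 0" if "a \<ge> 1 + int j + int N" for a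
      using that by (intro coord_op_deriv_op_support[OF N]) simp
  qed
  then show ?thesis
    by (simp add: coord_op_def deriv_op_def nat_add_distrib add_ac)
qed

lemma sum_sum_delta:
  "(\<Sum>u\<in>UNIV. \<Sum>v\<in>UNIV. if u = i then if v = j then z else 0 else 0) = (z :: complex)"
  for i j :: "'n::finite"
proof -
  have "(\<Sum>v\<in>UNIV. if u = i then if v = j then z else 0 else 0) = (if u = i then z else 0)" for u
    by (cases "u = i") simp_all
  then show ?thesis by simp
qed

lemma mat_field_mat_unit: "mat_field (mat_unit u v) k f = loop_field u v k f"
proof -
  have "mat_unit u v $ u' $ v' * loop_field u' v' k f x = (if u' = u then if v' = v then loop_field u v k f x else 0 else 0)" for u' v' x
    by (auto simp: mat_unit_def)
  then show ?thesis by (simp add: mat_field_def fun_eq_iff sum_sum_delta)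
qed

lemma mat_field_diff: "mat_field (A - B) k f = (\<lambda>x. mat_field A k f x - mat_field B k f x)"
  by (simp add: mat_field_def left_diff_distrib sum_subtractf)

lemma prescribed_action_affine_action:
  "prescribed_action lam (affine_action lam :: 'n::finite affine_op)"
proof -
  have loop: "affine_action lam (loop A m) f = loop_action lam A m f" for A :: "complex^'n^'n" and m f
    by (simp add: loop_def affine_action_single fun_eq_iff)
  have nonneg: "nonneg_op u v j f x = - loop_field u v (int j) f x" for u v :: 'n and j f x
    unfolding nonneg_op_def using loop_field_nonneg_sums[of v j x u f] by (simp add: sums_iff)
  show ?thesis
    unfolding prescribed_action_def has_central_charge_def
  proof (intro conjI ballI allI impI)
    show "affine_linear lam (affine_action lam)"
      by (auto simp: affine_linear_def fun_eq_iff affine_action_add affine_action_scale eigenspaceD(1))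
    show "affine_action lam central_K f = (\<lambda>x. 1 * f x)" for f
      by (simp add: affine_action_def central_K_def)
  next
    fix a :: "complex^'n^'n" and j and f :: "'n rminus \<Rightarrow> complex"
    show "affine_action lam (loop a (int j)) f = (\<lambda>x. \<Sum>u\<in>UNIV. \<Sum>v\<in>UNIV. a $ u $ v * nonneg_op u v j f x)"
      by (simp add: loop nonneg loop_action_def mat_field_def sum_negf)
  next
    fix u v :: 'n and j :: nat and f :: "'n rminus \<Rightarrow> complex" assume "j > 0"
    have "(\<lambda>z. suminf (\<lambda>i. of_real (coord v (Suc i) z) * partial u (Suc i + j) f z)) = loop_field u v (- int j) f"
      by (intro ext) (rule loop_field_neg_sums[THEN sums_unique, symmetric])
    then show "affine_action lam (loop (mat_unit u v) (- int j)) f =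
          (\<lambda>x. - (lam powi (- int j)) *
             (pi_t ^^ j) (\<lambda>z. suminf (\<lambda>i. of_real (coord v (Suc i) z) * partial u (Suc i + j) f z)) x)"
      by (simp only: loop loop_action_def mat_field_mat_unit) simp
  next
    fix u v :: 'n and j :: nat and f :: "'n rminus \<Rightarrow> complex" assume "j > 0"
    have "(\<lambda>z. suminf (\<lambda>i. of_real (coord u (Suc i) z) * partial u (Suc i + j) f z
        - of_real (coord v (Suc i) z) * partial v (Suc i + j) f z))
        = (\<lambda>z. loop_field u u (- int j) f z - loop_field v v (- int j) f z)"
      by (intro ext) (rule sums_unique[OF sums_diff[OF loop_field_neg_sums loop_field_neg_sums], symmetric])
    then show "affine_action lam (loop (mat_unit u u - mat_unit v v) (- int j)) f =
          (\<lambda>x. - (lam powi (- int j)) *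
             (pi_t ^^ j) (\<lambda>z. suminf (\<lambda>i. of_real (coord u (Suc i) z) * partial u (Suc i + j) f z
                                       - of_real (coord v (Suc i) z) * partial v (Suc i + j) f z)) x)"
      by (simp only: loop loop_action_def mat_field_diff mat_field_mat_unit) simp
  qed
qed


section \<open>Uniqueness of the prescribed action\<close>

lemma sl_zero: "0 \<in> sl"
  by (simp add: sl_def trace_def)

lemma sl_add: "A \<in> sl \<Longrightarrow> B \<in> sl \<Longrightarrow> A + B \<in> sl"
  by (simp add: sl_def trace_add)

lemma sl_scale: "A \<in> sl \<Longrightarrow> map_matrix ((*) c) A \<in> sl"
  by (simp add: sl_def trace_def map_matrix_def sum_distrib_left[symmetric])

lemma affine_algebra_add: "X \<in> affine_algebra \<Longrightarrow> Y \<in> affine_algebra \<Longrightarrow> X + Y \<in> affine_algebra"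
  by (simp add: affine_algebra_def lookup_add sl_add)

lemma affine_algebra_scale: "X \<in> affine_algebra \<Longrightarrow> affine_scale c X \<in> affine_algebra"
  by (simp add: affine_algebra_def lookup_fst_affine_scale sl_scale)

lemma loop_affine_algebra: "A \<in> sl \<Longrightarrow> loop A m \<in> affine_algebra"
  by (simp add: affine_algebra_def loop_def lookup_single when_def sl_zero)

lemma loop_add: "loop (A + B) m = loop A m + loop B m"
  by (simp add: loop_def single_add)

lemma loop_zero: "loop 0 m = 0"
  by (simp add: loop_def zero_prod_def)

lemma loop_scale: "loop (map_matrix ((*) c) A) m = affine_scale c (loop A m)"
proof (rule prod_eqI)
  show "fst (loop (map_matrix ((*) c) A) m) = fst (affine_scale c (loop A m))"
    by (rule poly_mapping_eqI)
       (auto simp: lookup_fst_affine_scale loop_def lookup_single when_def map_matrix_def vec_eq_iff)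
qed (simp add: loop_def affine_scale_def)

lemma affine_scale_zero: "affine_scale 0 X = 0"
proof (rule prod_eqI)
  show "fst (affine_scale 0 X) = fst 0"
    by (rule poly_mapping_eqI) (simp add: lookup_fst_affine_scale map_matrix_def vec_eq_iff)
qed (simp add: affine_scale_def)

lemma loop_ext_decompose:
  "X = (\<Sum>m\<in>Poly_Mapping.keys (fst X). loop (Poly_Mapping.lookup (fst X) m) m) + affine_scale (snd X) central_K"
proof (rule prod_eqI)
  let ?S = "\<Sum>m\<in>Poly_Mapping.keys (fst X). loop (Poly_Mapping.lookup (fst X) m) m"
  show "fst X = fst (?S + affine_scale (snd X) central_K)"
  proof (rule poly_mapping_eqI)
    fix k
    have "Poly_Mapping.lookup (fst X) k = (\<Sum>m\<in>Poly_Mapping.keys (fst X). if m = k then Poly_Mapping.lookup (fst X) m else 0)"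
      by (simp add: in_keys_iff)
    then show "Poly_Mapping.lookup (fst X) k = Poly_Mapping.lookup (fst (?S + affine_scale (snd X) central_K)) k"
      by (simp add: lookup_add fst_sum lookup_sum loop_def lookup_single when_def lookup_fst_affine_scale
        central_K_def map_matrix_def vec_eq_iff)
  qed
  show "snd X = snd (?S + affine_scale (snd X) central_K)"
    by (simp add: snd_sum loop_def affine_scale_def central_K_def)
qed

text \<open>
  Subtracting \<open>mat_unit w w\<close> from each diagonal unit changes the sum by \<open>trace A\<close> times
  \<open>mat_unit w w\<close>, which is zero.
\<close>

lemma sl_decompose:
  fixes A :: "complex^'n^'n::finite"
  assumes "A \<in> sl"
  shows "A = (\<Sum>u\<in>UNIV. \<Sum>v\<in>UNIV. map_matrix ((*) (A $ u $ v))
    (if u = v then mat_unit u u - mat_unit w w else mat_unit u v))"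
proof -
  have "(\<Sum>u\<in>UNIV. \<Sum>v\<in>UNIV. map_matrix ((*) (A $ u $ v))
    (if u = v then mat_unit u u - mat_unit w w else mat_unit u v)) $ i $ j = A $ i $ j" for i j
  proof -
    have "(\<Sum>u\<in>UNIV. \<Sum>v\<in>UNIV. map_matrix ((*) (A $ u $ v))
      (if u = v then mat_unit u u - mat_unit w w else mat_unit u v)) $ i $ j
      = (\<Sum>u\<in>UNIV. \<Sum>v\<in>UNIV. (if u = i then if v = j then A $ i $ j else 0 else 0)
          - A $ u $ v * (if u = v \<and> True then mat_unit w w $ i $ j else 0))"
      by (intro trans[OF sum_component] trans[OF sum_component] sum.cong refl trans[OF arg_cong[OF sum_component, of "\<lambda>z. z $ j"]])
         (auto simp: map_matrix_def mat_unit_def)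
    also have "\<dots> = A $ i $ j - trace A * mat_unit w w $ i $ j"
      unfolding sum_subtractf sum_diag sum_sum_delta by simp
    finally show ?thesis using assms by (simp add: sl_def)
  qed
  then show ?thesis by (simp add: vec_eq_iff)
qed

text \<open>
  Two linear maps agree on the subspace spanned by the elements on which both are prescribed. For
  negative powers of \<open>t\<close> these elements span by \<open>sl_decompose\<close>.
\<close>

lemma prescribed_action_unique:
  fixes \<pi> :: "'n::finite affine_op"
  assumes \<pi>: "prescribed_action lam \<pi>" and X: "X \<in> affine_algebra" and f: "f \<in> eigenspace lam"
  shows "\<pi> X f = affine_action lam X f"
proof -
  define G where "G = {X \<in> affine_algebra. \<forall>f\<in>eigenspace lam. \<pi> X f = affine_action lam X f}"
  note P = \<pi>[unfolded prescribed_action_def affine_linear_def has_central_charge_def]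
  note Q = prescribed_action_affine_action[where 'n = 'n, of lam, unfolded prescribed_action_def affine_linear_def has_central_charge_def]
  have add: "X + Y \<in> G" if "X \<in> G" "Y \<in> G" for X Y
    using that P Q by (auto simp: G_def affine_algebra_add)
  have scale: "affine_scale c X \<in> G" if "X \<in> G" for c X
    using that P Q by (auto simp: G_def affine_algebra_scale)
  have K: "central_K \<in> G"
    using P Q by (auto simp: G_def affine_algebra_def central_K_def sl_zero)
  have zero: "0 \<in> G"
    using scale[OF K, of 0] by (simp add: affine_scale_zero)
  have sum: "(\<Sum>i\<in>I. Z i) \<in> G" if "\<And>i. i \<in> I \<Longrightarrow> Z i \<in> G" for I :: "'i set" and Z
    using that by (induction I rule: infinite_finite_induct) (auto simp: zero add)
  have unit_sl: "mat_unit u v \<in> sl" if "u \<noteq> v" for u v :: 'n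
    using that by (auto simp: sl_def trace_def mat_unit_def intro: sum.neutral)
  have diff_sl: "mat_unit u u - mat_unit v v \<in> sl" for u v :: 'n
    by (simp add: sl_def trace_def mat_unit_def sum_subtractf)
  have neg: "loop (if u = v then mat_unit u u - mat_unit w w else mat_unit u v) (- int j) \<in> G"
    if j: "j > 0" for u v w :: 'n and j
  proof -
    have "loop (mat_unit u v) (- int j) \<in> G" if "u \<noteq> v"
      using that j P Q by (auto simp: G_def loop_affine_algebra unit_sl)
    moreover have "loop (mat_unit u u - mat_unit w w) (- int j) \<in> G"
    proof (cases "u = w")
      case True
      then show ?thesis by (simp add: loop_zero zero)
    next
      case False
      then show ?thesis
        using j P Q by (auto simp: G_def loop_affine_algebra diff_sl)
    qed
    ultimately show ?thesis by (cases "u = v") simp_all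
  qed
  have loop: "loop A m \<in> G" if A: "A \<in> sl" for A m
  proof (cases "m \<ge> 0")
    case True
    then obtain j where "m = int j" using nonneg_int_cases by blast
    then show ?thesis
      using A P Q by (auto simp: G_def loop_affine_algebra)
  next
    case False
    then have "m = - int (nat (- m))" "nat (- m) > 0" by auto
    then obtain j where j: "m = - int j" "j > 0" by blast
    have loop_sum: "loop (\<Sum>i\<in>I. B i) m = (\<Sum>i\<in>I. loop (B i) m)" for I :: "'n set" and B
      by (induction I rule: infinite_finite_induct) (simp_all add: loop_zero loop_add)
    show ?thesis
      unfolding j(1)
      \<comment> \<open>Any index can serve as the reference index \<open>w\<close>.\<close>
      by (subst sl_decompose[OF A, of undefined]) (simp only: loop_sum[unfolded j(1)] loop_scale, intro sum scale neg j)
  qed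
  have "X \<in> G"
    using X by (subst loop_ext_decompose, intro add sum scale loop K) (auto simp: affine_algebra_def)
  then show ?thesis using f by (simp add: G_def)
qed

theorem theorem4p2:
  fixes lam :: complex
  assumes "CARD('n::finite) \<ge> 2" and "lam \<noteq> 0"
  shows "(\<exists>\<pi> :: 'n affine_op. prescribed_action lam \<pi>) \<and>
         (\<forall>\<pi> :: 'n affine_op. prescribed_action lam \<pi> \<longrightarrow>
            affine_representation lam \<pi> \<and> has_central_charge lam \<pi> 1)"
proof (intro conjI allI impI)
  show "\<exists>\<pi> :: 'n affine_op. prescribed_action lam \<pi>"
    using prescribed_action_affine_action by blast
  fix \<pi> :: "'n affine_op" assume \<pi>: "prescribed_action lam \<pi>"
  then show "has_central_charge lam \<pi> 1" by (simp add: prescribed_action_def)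
  note eq = prescribed_action_unique[OF \<pi>]
  have rep: "affine_representation lam (affine_action lam :: 'n affine_op)"
    using assms(2) by (rule affine_representation_affine_action)
  show "affine_representation lam \<pi>"
    unfolding affine_representation_def
  proof (intro conjI ballI)
    show "affine_linear lam \<pi>" using \<pi> by (simp add: prescribed_action_def)
  next
    fix X :: "'n loop_ext" assume X: "X \<in> affine_algebra"
    then have "endomorphism lam (affine_action lam X)"
      by (rule endomorphism_affine_action)
    then show "endomorphism lam (\<pi> X)"
      by (simp add: endomorphism_def eq[OF X] eigenspace_add eigenspace_cmult)
  next
    fix X Y :: "'n loop_ext" and f :: "'n rminus \<Rightarrow> complex"
    assume X: "X \<in> affine_algebra" and Y: "Y \<in> affine_algebra" and f: "f \<in> eigenspace lam"
    have "affine_action lam (affine_bracket X Y) f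
       = (\<lambda>x. affine_action lam X (affine_action lam Y f) x - affine_action lam Y (affine_action lam X f) x)"
      using rep X Y f by (simp add: affine_representation_def)
    then show "\<pi> (affine_bracket X Y) f = (\<lambda>x. \<pi> X (\<pi> Y f) x - \<pi> Y (\<pi> X f) x)"
      by (simp add: eq X Y f affine_bracket_closed affine_action_eigenspace)
  qed
qed

end
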